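(* Let $m\in\mathbb N$ and let $\varphi\in \mathscr K(\mathbb R^m)$. For every $x\in\mathbb R^m$ the function defined by $$f(x,t) = \begin{cases} \dfrac{(4\pi)^{-\frac m2}\, e^{\frac{imt}{2}}}{e^{\frac{i\pi m}{4}}\,(\sin t)^{\frac m2}} \displaystyle\int_{\mathbb R^m} e^{\, i\,\frac{|e^{it/2}y-e^{-it/2}x|^2}{4\sin t}}\,\varphi(y)\,dy, & t\in J^+,\\[3mm] \dfrac{(4\pi)^{-\frac m2}\, e^{\frac{imt}{2}}}{e^{\frac{i3\pi m}{4}}\,|\sin t|^{\frac m2}} \displaystyle\int_{\mathbb R^m} e^{-i\,\frac{|e^{it/2}y-e^{-it/2}x|^2}{4|\sin t|}}\,\varphi(y)\,dy, & t\in J^-, \end{cases}$$ and $f(x,0)=\varphi(x)$, solves in $\mathbb R^m\times J$ the Cauchy problem $$\partial_t f - i\left(\Delta f-\langle x,\nabla f\rangle\right)=0,\qquad f(x,0)=\varphi(x).$$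
   Context: Functions are complex-valued; $\Delta$ and $\nabla$ are taken in the variable $x\in\mathbb R^m$. $\mathscr S(\mathbb R^m)$ is the Schwartz space, and $\mathscr K(\mathbb R^m)=\{\varphi\in C^\infty(\mathbb R^m) : \psi\in\mathscr S(\mathbb R^m)\}$, where $\psi(x)=e^{-|x|^2/4}\varphi(x)$. Notation: $J^+=(0,\pi)$, $J^-=(\pi,2\pi)$, $J=J^+\cup J^-$. For $x,y\in\mathbb R^m$ the expression $|e^{it/2}y-e^{-it/2}x|^2$ is not a Hermitian norm; it denotes the complex-bilinear quantity $e^{it}|y|^2+e^{-it}|x|^2-2\langle x,y\rangle$. *)

theory Defs
  imports "HOL-Analysis.Analysis"
begin

definition partial :: "'m::finite \<Rightarrow> (real^'m \<Rightarrow> complex) \<Rightarrow> real^'m \<Rightarrow> complex" where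
  "partial i g x = frechet_derivative g (at x) (axis i 1)"

text \<open>A list of coordinates encodes a partial derivative of order equal to its length.\<close>
definition partials :: "'m::finite list \<Rightarrow> (real^'m \<Rightarrow> complex) \<Rightarrow> real^'m \<Rightarrow> complex" where
  "partials ks g = foldr partial ks g"

definition gradient :: "(real^'m::finite \<Rightarrow> complex) \<Rightarrow> real^'m \<Rightarrow> complex^'m" where
  "gradient g x = (\<chi> i. partial i g x)"

definition laplacian :: "(real^'m::finite \<Rightarrow> complex) \<Rightarrow> real^'m \<Rightarrow> complex" where
  "laplacian g x = (\<Sum>i\<in>UNIV. partial i (partial i g) x)"

text \<open>The bilinear pairing of a real with a complex vector; the library inner product on
  \<^typ>\<open>complex^'m\<close> is real-valued and cannot be used for it.\<close>
definition pairing :: "real^'m::finite \<Rightarrow> complex^'m \<Rightarrow> complex" where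
  "pairing x v = (\<Sum>i\<in>UNIV. of_real (x $ i) * v $ i)"

text \<open>The class of all infinitely differentiable functions: total differentiability of
  every iterated partial derivative also makes all of them continuous.\<close>
definition smooth :: "(real^'m::finite \<Rightarrow> complex) set" where
  "smooth = {g. \<forall>ks x. partials ks g differentiable (at x)}"

definition schwartz_space :: "(real^'m::finite \<Rightarrow> complex) set" where
  "schwartz_space =
     {g \<in> smooth. \<forall>k ks. bounded (range (\<lambda>x. norm x ^ k *\<^sub>R partials ks g x))}"

definition K_space :: "(real^'m::finite \<Rightarrow> complex) set" where
  "K_space =
     {\<phi> \<in> smooth. (\<lambda>x. of_real (exp (- (norm x)\<^sup>2 / 4)) * \<phi> x) \<in> schwartz_space}"

definition J_plus :: "real set" where "J_plus = {0<..<pi}"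
definition J_minus :: "real set" where "J_minus = {pi<..<2 * pi}"
definition J_times :: "real set" where "J_times = J_plus \<union> J_minus"

text \<open>The complex-bilinear (not Hermitian) square of \<open>e\<^sup>i\<^sup>t\<^sup>/\<^sup>2 y - e\<^sup>-\<^sup>i\<^sup>t\<^sup>/\<^sup>2 x\<close>.\<close>
definition bilin_sq :: "real \<Rightarrow> real^'m::finite \<Rightarrow> real^'m \<Rightarrow> complex" where
  "bilin_sq t x y =
     exp (\<i> * of_real t) * of_real ((norm y)\<^sup>2) + exp (- \<i> * of_real t) * of_real ((norm x)\<^sup>2)
       - 2 * of_real (x \<bullet> y)"

text \<open>Regularity of a classical solution: one derivative in time and two in space,
  all jointly continuous.\<close>
definition C21_on_J :: "(real^'m::finite \<Rightarrow> real \<Rightarrow> complex) \<Rightarrow> bool" where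
  "C21_on_J f \<longleftrightarrow>
     (\<forall>t\<in>J_times. \<forall>x. (\<lambda>s. f x s) differentiable (at t)) \<and>
     continuous_on (UNIV \<times> J_times) (\<lambda>(x, t). vector_derivative (\<lambda>s. f x s) (at t)) \<and>
     (\<forall>t\<in>J_times. \<forall>ks x. length ks < 2 \<longrightarrow>
        partials ks (\<lambda>z. f z t) differentiable (at x)) \<and>
     (\<forall>ks. length ks \<le> 2 \<longrightarrow>
        continuous_on (UNIV \<times> J_times) (\<lambda>(x, t). partials ks (\<lambda>z. f z t) x))"

text \<open>Joint continuity on \<^term>\<open>UNIV \<times> insert 0 J_times\<close> says that the initial datum is attained
  as \<open>t\<close> decreases to \<open>0\<close>. Values of \<open>f\<close> at times outside \<^term>\<open>insert 0 J_times\<close> play no role.\<close>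
definition solves_cauchy_problem ::
    "(real^'m::finite \<Rightarrow> complex) \<Rightarrow> (real^'m \<Rightarrow> real \<Rightarrow> complex) \<Rightarrow> bool" where
  "solves_cauchy_problem \<phi> f \<longleftrightarrow>
     C21_on_J f \<and>
     (\<forall>x. \<forall>t\<in>J_times.
        vector_derivative (\<lambda>s. f x s) (at t)
          - \<i> * (laplacian (\<lambda>z. f z t) x - pairing x (gradient (\<lambda>z. f z t) x)) = 0) \<and>
     continuous_on (UNIV \<times> insert 0 J_times) (\<lambda>(x, t). f x t) \<and>
     (\<forall>x. f x 0 = \<phi> x)"

end

theory Submission
  imports Defs "HOL-Probability.Characteristic_Functions" "HOL-Probability.Sinc_Integral"
begin

text \<open>With \<open>\<psi>(x) = exp(-|x|\<^sup>2/4) \<phi>(x)\<close> both branches of the formula take the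
  form \<open>f(x,t) = c(t) exp((1 + i cot t)|x|\<^sup>2/4) G(cot t / 4, x / (2 sin t))\<close>, where
  \<open>G(a,b) = \<integral> exp(i a |y|\<^sup>2 - i \<langle>b,y\<rangle>) \<psi>(y) dy\<close> and \<open>c' = i m (1 + i cot t)/2 \<cdot> c\<close>. Since \<open>\<psi>\<close> has
  moments of all orders, \<open>G\<close> may be differentiated under the integral sign, each derivative only
  multiplying \<open>\<psi>\<close> by a polynomial, and the equation becomes an algebraic identity.

  The initial condition is the hard part, because the kernel has constant modulus and its
  prefactor blows up as \<open>t\<close> tends to \<open>0\<close>. Completing the square gives a free Schroedinger evolution of \<open>\<psi>\<close> at time
  \<open>tan t\<close> and position \<open>x / cos t\<close>. The Fourier transform of a Gaussian with complex parameter
  \<open>\<alpha> = \<epsilon> + i s\<close> and Fubini turn it, after \<open>\<epsilon> \<rightarrow> 0\<close>, into an integral of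
  \<open>exp(-i s |\<xi>|\<^sup>2)\<close> against the integrable Fourier transform of \<open>\<psi>\<close>, which is continuous up
  to \<open>s = 0\<close>, where Fourier inversion identifies its value.\<close>

section \<open>Oscillatory integrals\<close>

text \<open>The integral \<open>osc\<close> serves in three roles: as \<open>G\<close> it carries
  the solution, with \<open>a = 0\<close> it is the Fourier transform, and with a Gaussian weight it
  is the Gaussian integral with complex parameter. One continuity theorem and one differentiation
  theorem therefore cover all of them. The complex Gaussian is computed from differential equations
  in its parameters rather than by shifting contours; the integrations by parts behind them rest on
  translation invariance. The amplitude satisfies the same linear equation whatever its constant
  factor, so the equation cannot detect exp(-i pi m/4); the initial condition does. On (0, pi/2) one
  has tan t > 0, and the principal root of i tan t contributes exp(i pi/4) once per dimension, which
  produces exactly this factor. Complex roots are taken before the m-th power, which settles the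
  branch for odd m. The initial value is attained jointly in (x,t), not merely for fixed x, because
  \<open>osc\<close> of an integrable function is continuous in both parameters together.\<close>

definition osc :: "('a::euclidean_space \<Rightarrow> complex) \<Rightarrow> real \<Rightarrow> 'a \<Rightarrow> complex" where
  "osc \<rho> a b = (LINT y|lborel. cis (a * (norm y)\<^sup>2 - b \<bullet> y) * \<rho> y)"

text \<open>Finite moments rather than pointwise decay: this class is closed under multiplication by
  the polynomials that differentiation in \<open>a\<close> and \<open>b\<close> produces, so
  differentiation under the integral sign can be repeated.\<close>

definition rapid :: "('a::euclidean_space \<Rightarrow> complex) \<Rightarrow> bool" where
  "rapid \<rho> \<longleftrightarrow> \<rho> \<in> borel_measurable borel \<and>
     (\<forall>k. integrable lborel (\<lambda>y. norm y ^ k * norm (\<rho> y)))"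

lemma rapid_measurable: "rapid \<rho> \<Longrightarrow> \<rho> \<in> borel_measurable borel"
  by (simp add: rapid_def)

lemma rapid_integrable_moment: "rapid \<rho> \<Longrightarrow> integrable lborel (\<lambda>y. norm y ^ k * norm (\<rho> y))"
  by (simp add: rapid_def)

lemma rapid_integrable:
  assumes "rapid \<rho>" shows "integrable lborel \<rho>"
  using rapid_integrable_moment[OF assms, of 0] rapid_measurable[OF assms]
  by (simp add: integrable_norm_iff)

text \<open>A multiplier bounded by |y|^n shifts the k-th moment to the (k+n)-th. It is applied to
  coordinates (n = 1) and to the squared norm (n = 2).\<close>

lemma rapid_mult_power_bound:
  assumes "rapid \<rho>" and [measurable]: "p \<in> borel_measurable borel"
    and p: "\<And>y. norm (p y) \<le> norm y ^ n"
  shows "rapid (\<lambda>y. p y * \<rho> y)"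
  unfolding rapid_def
proof (intro conjI allI)
  have [measurable]: "\<rho> \<in> borel_measurable borel"
    using assms(1) by (rule rapid_measurable)
  show "(\<lambda>y. p y * \<rho> y) \<in> borel_measurable borel" by measurable
  fix k
  show "integrable lborel (\<lambda>y. norm y ^ k * norm (p y * \<rho> y))"
  proof (rule Bochner_Integration.integrable_bound)
    show "integrable lborel (\<lambda>y. norm y ^ (k + n) * norm (\<rho> y))"
      by (rule rapid_integrable_moment) fact
    have "norm y ^ k * (norm (p y) * norm (\<rho> y)) \<le> norm y ^ k * (norm y ^ n * norm (\<rho> y))" for y
      by (intro mult_left_mono mult_right_mono p) auto
    then show "AE y in lborel. norm (norm y ^ k * norm (p y * \<rho> y))
        \<le> norm (norm y ^ (k + n) * norm (\<rho> y))"
      by (simp add: norm_mult power_add mult.assoc)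
  qed measurable
qed

lemma rapid_mult_coordinate:
  "rapid \<rho> \<Longrightarrow> norm i \<le> 1 \<Longrightarrow> rapid (\<lambda>y. of_real (y \<bullet> i) * \<rho> y)"
  using mult_left_mono[of "norm i" 1 "norm y" for y]
  by (intro rapid_mult_power_bound[where n = 1])
     (auto intro: order_trans[OF Cauchy_Schwarz_ineq2])

lemma rapid_mult_norm_sq: "rapid \<rho> \<Longrightarrow> rapid (\<lambda>y. of_real ((norm y)\<^sup>2) * \<rho> y)"
  by (rule rapid_mult_power_bound[where n = 2]) (auto simp: norm_power)

lemma integrable_osc:
  assumes "integrable lborel \<rho>"
  shows "integrable lborel (\<lambda>y. cis (a * (norm y)\<^sup>2 - b \<bullet> y) * \<rho> y)"
proof (rule Bochner_Integration.integrable_bound[OF assms])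
  have [measurable]: "\<rho> \<in> borel_measurable borel"
    using borel_measurable_integrable[OF assms] by simp
  have "continuous_on UNIV (\<lambda>y. cis (a * (norm y)\<^sup>2 - b \<bullet> y))"
    by (intro continuous_intros)
  then have [measurable]: "(\<lambda>y. cis (a * (norm y)\<^sup>2 - b \<bullet> y)) \<in> borel_measurable borel"
    by (rule borel_measurable_continuous_onI)
  show "(\<lambda>y. cis (a * (norm y)\<^sup>2 - b \<bullet> y) * \<rho> y) \<in> borel_measurable lborel"
    by measurable
qed (simp add: norm_mult)

text \<open>The phase factor has modulus one, so |\<rho>| is a majorant for all parameters at once
  and dominated convergence applies along any sequence of pairs (a,b).\<close>

lemma continuous_osc:
  fixes \<rho> :: "'a::euclidean_space \<Rightarrow> complex"
  assumes "integrable lborel \<rho>"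
  shows "continuous_on UNIV (\<lambda>p. osc \<rho> (fst p) (snd p))"
  unfolding continuous_on_sequentially
proof (intro allI ballI impI, elim conjE)
  fix q :: "nat \<Rightarrow> real \<times> 'a" and p
  assume q: "q \<longlonglongrightarrow> p"
  have "(\<lambda>n. osc \<rho> (fst (q n)) (snd (q n))) \<longlonglongrightarrow> osc \<rho> (fst p) (snd p)"
    unfolding osc_def
  proof (rule integral_dominated_convergence[where w = "\<lambda>y. norm (\<rho> y)"])
    show "AE y in lborel. (\<lambda>n. cis (fst (q n) * (norm y)\<^sup>2 - snd (q n) \<bullet> y) * \<rho> y)
        \<longlonglongrightarrow> cis (fst p * (norm y)\<^sup>2 - snd p \<bullet> y) * \<rho> y"
      by (intro AE_I2 tendsto_intros q)
  qed (use assms integrable_osc[OF assms] in \<open>auto simp: norm_mult dest: borel_measurable_integrable\<close>)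
  then show "((\<lambda>p. osc \<rho> (fst p) (snd p)) \<circ> q) \<longlonglongrightarrow> osc \<rho> (fst p) (snd p)"
    by (simp add: o_def)
qed

lemma norm_cis_quadratic_remainder: "norm (cis u - 1 - \<i> * of_real u) \<le> u\<^sup>2 / 2"
  using iexp_approx1[of u 1] by (simp add: cis_conv_exp algebra_simps power2_eq_square)

text \<open>A derivative jointly in (a,b) lets the chain rule run along curves such as (cot t / 4, x
  / (2 sin t)). The phase increment u is linear in h with |u| \<le> |h| (|y|^2 + |y|), so the
  quadratic remainder of \<open>cis\<close> integrates to at most M |h|^2, where M is finite by the
  moments of orders two to four.\<close>

lemma osc_has_derivative:
  fixes \<rho> :: "'a::euclidean_space \<Rightarrow> complex"
  assumes \<rho>: "rapid \<rho>"
  shows "((\<lambda>p. osc \<rho> (fst p) (snd p)) has_derivative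
    (\<lambda>h. \<i> * (of_real (fst h) * osc (\<lambda>y. of_real ((norm y)\<^sup>2) * \<rho> y) a b
        - (\<Sum>i\<in>Basis. of_real (snd h \<bullet> i) * osc (\<lambda>y. of_real (y \<bullet> i) * \<rho> y) a b)))) (at (a, b))"
    (is "(?f has_derivative ?D) _")
proof -
  define M where "M = (LINT y|lborel. ((norm y)\<^sup>2 + norm y)\<^sup>2 / 2 * norm (\<rho> y))"
  have intM: "integrable lborel (\<lambda>y. ((norm y)\<^sup>2 + norm y)\<^sup>2 / 2 * norm (\<rho> y))"
  proof -
    have "integrable lborel (\<lambda>y. (norm y ^ 4 * norm (\<rho> y) + 2 * (norm y ^ 3 * norm (\<rho> y))
        + norm y ^ 2 * norm (\<rho> y)) / 2)"
      by (intro Bochner_Integration.integrable_add integrable_mult_right integrable_divide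
          rapid_integrable_moment \<rho>)
    moreover have "(\<lambda>y. (norm y ^ 4 * norm (\<rho> y) + 2 * (norm y ^ 3 * norm (\<rho> y))
        + norm y ^ 2 * norm (\<rho> y)) / 2) = (\<lambda>y. ((norm y)\<^sup>2 + norm y)\<^sup>2 / 2 * norm (\<rho> y))"
      by (intro ext) (simp add: field_simps power2_eq_square eval_nat_numeral)
    ultimately show ?thesis by simp
  qed
  define e where "e = (\<lambda>y. cis (a * (norm y)\<^sup>2 - b \<bullet> y))"
  then have e: "cis (a * (norm y)\<^sup>2 - b \<bullet> y) = e y" for y by simp
  have int0: "integrable lborel (\<lambda>y. e y * \<rho> y)"
    unfolding e_def by (intro integrable_osc rapid_integrable \<rho>)
  have int1: "integrable lborel (\<lambda>y. e y * (of_real ((norm y)\<^sup>2) * \<rho> y))"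
    unfolding e_def by (intro integrable_osc rapid_integrable rapid_mult_norm_sq \<rho>)
  have int2: "integrable lborel (\<lambda>y. e y * (of_real (y \<bullet> i) * \<rho> y))" if "i \<in> Basis" for i
    unfolding e_def using that
    by (intro integrable_osc rapid_integrable rapid_mult_coordinate \<rho>) auto
  define u where "u = (\<lambda>(h :: real \<times> 'a) y. fst h * (norm y)\<^sup>2 - snd h \<bullet> y)"
  \<comment> \<open>Expanding the inner product in the basis turns the candidate derivative into a
    single integral, which can be subtracted under the integral sign.\<close>
  have D: "integrable lborel (\<lambda>y. \<i> * (of_real (u h y) * (e y * \<rho> y)))"
    "?D h = (LINT y|lborel. \<i> * (of_real (u h y) * (e y * \<rho> y)))" for h
  proof -
    have "of_real (u h y) * (e y * \<rho> y) = of_real (fst h) * (e y * (of_real ((norm y)\<^sup>2) * \<rho> y))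
      - (\<Sum>i\<in>Basis. of_real (snd h \<bullet> i) * (e y * (of_real (y \<bullet> i) * \<rho> y)))" for y
      unfolding u_def euclidean_inner[of "snd h" y]
      by (simp add: algebra_simps sum_distrib_left sum_distrib_right)
    moreover have "integrable lborel (\<lambda>y. of_real (fst h) * (e y * (of_real ((norm y)\<^sup>2) * \<rho> y)))"
      by (intro integrable_mult_right int1)
    moreover have i2: "integrable lborel
        (\<lambda>y. of_real (snd h \<bullet> i) * (e y * (of_real (y \<bullet> i) * \<rho> y)))" if "i \<in> Basis" for i
      by (intro integrable_mult_right int2 that)
    moreover from i2 have "integrable lborel
        (\<lambda>y. \<Sum>i\<in>Basis. of_real (snd h \<bullet> i) * (e y * (of_real (y \<bullet> i) * \<rho> y)))"
      by (rule Bochner_Integration.integrable_sum)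
    ultimately show "integrable lborel (\<lambda>y. \<i> * (of_real (u h y) * (e y * \<rho> y)))"
      "?D h = (LINT y|lborel. \<i> * (of_real (u h y) * (e y * \<rho> y)))"
      unfolding osc_def e
      by (simp_all add: Bochner_Integration.integral_diff Bochner_Integration.integral_sum)
  qed
  have bound: "norm (?f ((a, b) + h) - ?f (a, b) - ?D h) \<le> M * norm h ^ 2" for h
  proof -
    have split: "cis ((a + fst h) * (norm y)\<^sup>2 - (b + snd h) \<bullet> y) = e y * cis (u h y)" for y
      by (simp add: u_def e_def cis_mult algebra_simps inner_add_left)
    have inth: "integrable lborel (\<lambda>y. e y * cis (u h y) * \<rho> y)"
      unfolding split[symmetric] by (intro integrable_osc rapid_integrable \<rho>)
    have "?f ((a, b) + h) - ?f (a, b) - ?D h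
        = (LINT y|lborel. e y * cis (u h y) * \<rho> y - e y * \<rho> y - \<i> * (of_real (u h y) * (e y * \<rho> y)))"
      using inth int0 D[of h] by (simp add: osc_def split e)
    also have "norm \<dots> \<le> (LINT y|lborel. norm h ^ 2 * (((norm y)\<^sup>2 + norm y)\<^sup>2 / 2 * norm (\<rho> y)))"
    proof (rule Bochner_Integration.integral_norm_bound_integral)
      fix y
      have "e y * cis (u h y) * \<rho> y - e y * \<rho> y - \<i> * (of_real (u h y) * (e y * \<rho> y))
          = e y * (cis (u h y) - 1 - \<i> * of_real (u h y)) * \<rho> y"
        by (simp add: algebra_simps)
      then have "norm (e y * cis (u h y) * \<rho> y - e y * \<rho> y - \<i> * (of_real (u h y) * (e y * \<rho> y)))
          \<le> (u h y)\<^sup>2 / 2 * norm (\<rho> y)"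
        using mult_right_mono[OF norm_cis_quadratic_remainder[of "u h y"] norm_ge_zero[of "\<rho> y"]]
        by (simp add: norm_mult e_def)
      also have "\<bar>u h y\<bar> \<le> norm h * ((norm y)\<^sup>2 + norm y)"
      proof -
        have "\<bar>u h y\<bar> \<le> \<bar>fst h\<bar> * (norm y)\<^sup>2 + norm (snd h) * norm y"
          using Cauchy_Schwarz_ineq2[of "snd h" y] unfolding u_def
          by (intro order_trans[OF abs_triangle_ineq4] add_mono) (simp_all add: abs_mult)
        also have "\<dots> \<le> norm h * (norm y)\<^sup>2 + norm h * norm y"
          using norm_fst_le[of "fst h" "snd h"] norm_snd_le[of "snd h" "fst h"]
          by (intro add_mono mult_right_mono) auto
        finally show ?thesis by (simp add: algebra_simps)
      qed
      then have "(u h y)\<^sup>2 \<le> (norm h * ((norm y)\<^sup>2 + norm y))\<^sup>2"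
        by (rule abs_le_square_iff[THEN iffD1, OF order_trans]) simp
      then have "(u h y)\<^sup>2 / 2 * norm (\<rho> y) \<le> (norm h * ((norm y)\<^sup>2 + norm y))\<^sup>2 / 2 * norm (\<rho> y)"
        by (intro mult_right_mono) auto
      finally show "norm (e y * cis (u h y) * \<rho> y - e y * \<rho> y - \<i> * (of_real (u h y) * (e y * \<rho> y)))
          \<le> norm h ^ 2 * (((norm y)\<^sup>2 + norm y)\<^sup>2 / 2 * norm (\<rho> y))"
        by (simp add: power_mult_distrib)
    next
      show "integrable lborel (\<lambda>y. e y * cis (u h y) * \<rho> y - e y * \<rho> y
          - \<i> * (of_real (u h y) * (e y * \<rho> y)))"
        by (intro Bochner_Integration.integrable_diff inth int0 D(1))
      show "integrable lborel (\<lambda>y. norm h ^ 2 * (((norm y)\<^sup>2 + norm y)\<^sup>2 / 2 * norm (\<rho> y)))"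
        by (intro integrable_mult_right intM)
    qed
    finally show ?thesis by (simp add: M_def mult.commute)
  qed
  have "((\<lambda>h. norm (?f ((a, b) + h) - ?f (a, b) - ?D h) / norm h) \<longlongrightarrow> 0) (at 0)"
  proof (rule Lim_null_comparison)
    show "\<forall>\<^sub>F h in at 0. norm (norm (?f ((a, b) + h) - ?f (a, b) - ?D h) / norm h) \<le> M * norm h"
      using bound by (intro eventually_at_filter[THEN iffD2] always_eventually)
        (auto simp: divide_le_eq power2_eq_square mult.assoc)
    show "((\<lambda>h :: real \<times> 'a. M * norm h) \<longlongrightarrow> 0) (at 0)"
      by (auto intro!: tendsto_eq_intros)
  qed
  moreover have "bounded_linear ?D"
    unfolding linear_conv_bounded_linear[symmetric]
    by (rule linearI) (simp_all add: algebra_simps inner_add_left sum.distrib sum_distrib_left scaleR_conv_of_real)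
  ultimately show ?thesis unfolding has_derivative_at by blast
qed

section \<open>Rapidly decreasing functions\<close>

lemma integrable_inverse_1_plus_square_real: "integrable lborel (\<lambda>x::real. inverse (1 + x\<^sup>2))"
  using integrable_inverse_1_plus_square by (simp add: set_integrable_def)

text \<open>Factorizing over the coordinates reduces every dimension to the integral of 1/(1 + x^2).
  The same majorant serves for decaying functions and for Fourier transforms.\<close>

lemma integrable_prod_inverse_1_plus_square:
  "integrable lborel (\<lambda>y::'a::euclidean_space. \<Prod>b\<in>Basis. inverse (1 + (y \<bullet> b)\<^sup>2))"
proof (rule integrableI_nonneg)
  have "(\<integral>\<^sup>+y. ennreal (\<Prod>b\<in>Basis. inverse (1 + ((y::'a) \<bullet> b)\<^sup>2)) \<partial>lborel)
      = (\<integral>\<^sup>+y. (\<Prod>b\<in>Basis. ennreal (inverse (1 + ((y::'a) \<bullet> b)\<^sup>2))) \<partial>lborel)"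
    by (simp add: prod_ennreal)
  also have "\<dots> = (\<Prod>b\<in>(Basis :: 'a set). \<integral>\<^sup>+x. ennreal (inverse (1 + x\<^sup>2)) \<partial>lborel)"
    by (rule nn_integral_lborel_prod) auto
  also have "(\<integral>\<^sup>+x. ennreal (inverse (1 + x\<^sup>2)) \<partial>lborel) = ennreal (LINT x|lborel. inverse (1 + x\<^sup>2))"
    by (intro nn_integral_eq_integral integrable_inverse_1_plus_square_real) auto
  finally show "(\<integral>\<^sup>+y. ennreal (\<Prod>b\<in>Basis. inverse (1 + ((y::'a) \<bullet> b)\<^sup>2)) \<partial>lborel) < \<infinity>"
    by (simp add: power_less_top_ennreal)
qed (auto intro!: prod_nonneg)

lemma one_plus_square_power_le: "(1 + r\<^sup>2) ^ n \<le> 2 ^ n * (1 + r ^ (2 * n))" for r :: real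
proof -
  have "(1 + r\<^sup>2) ^ n \<le> (2 * max 1 (r\<^sup>2)) ^ n"
    by (intro power_mono) auto
  also have "\<dots> \<le> 2 ^ n * (1 + r ^ (2 * n))"
    by (auto simp: max_def power_mult_distrib power_mult)
  finally show ?thesis .
qed

lemma rapidI:
  fixes \<rho> :: "'a::euclidean_space \<Rightarrow> complex"
  assumes [measurable]: "\<rho> \<in> borel_measurable borel"
    and bounded: "\<And>k. \<exists>C. \<forall>y. norm y ^ k * norm (\<rho> y) \<le> C"
  shows "rapid \<rho>"
  unfolding rapid_def
proof (intro conjI allI)
  fix k
  let ?n = "DIM('a)"
  obtain C where C: "\<And>y. norm y ^ k * norm (\<rho> y) \<le> C"
    using bounded[of k] by blast
  \<comment> \<open>The extra exponent pays for the product of the factors 1 + y_b^2, which is at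
    most 2^n (1 + |y|^(2n)).\<close>
  obtain C' where C': "\<And>y. norm y ^ (k + 2 * ?n) * norm (\<rho> y) \<le> C'"
    using bounded[of "k + 2 * ?n"] by blast
  show "integrable lborel (\<lambda>y. norm y ^ k * norm (\<rho> y))"
  proof (rule Bochner_Integration.integrable_bound)
    show "integrable lborel (\<lambda>y::'a. 2 ^ ?n * (C + C') * (\<Prod>b\<in>Basis. inverse (1 + (y \<bullet> b)\<^sup>2)))"
      by (intro integrable_mult_right integrable_prod_inverse_1_plus_square)
    have "norm y ^ k * norm (\<rho> y) \<le> 2 ^ ?n * (C + C') * (\<Prod>b\<in>Basis. inverse (1 + (y \<bullet> b)\<^sup>2))"
      for y :: 'a
    proof -
      have "(\<Prod>b\<in>Basis. 1 + (y \<bullet> b)\<^sup>2) \<le> (\<Prod>b\<in>(Basis :: 'a set). 1 + (norm y)\<^sup>2)"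
        by (intro prod_mono conjI add_left_mono)
           (auto intro!: abs_le_square_iff[THEN iffD1] simp: Basis_le_norm add_nonneg_nonneg)
      also have "\<dots> \<le> 2 ^ ?n * (1 + norm y ^ (2 * ?n))"
        using one_plus_square_power_le by simp
      finally have "norm y ^ k * norm (\<rho> y) * (\<Prod>b\<in>Basis. 1 + (y \<bullet> b)\<^sup>2)
          \<le> norm y ^ k * norm (\<rho> y) * (2 ^ ?n * (1 + norm y ^ (2 * ?n)))"
        by (intro mult_left_mono) auto
      also have "\<dots> = 2 ^ ?n * (norm y ^ k * norm (\<rho> y) + norm y ^ (k + 2 * ?n) * norm (\<rho> y))"
        by (simp add: algebra_simps power_add)
      also have "\<dots> \<le> 2 ^ ?n * (C + C')"
        by (intro mult_left_mono add_mono C C') auto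
      finally have "norm y ^ k * norm (\<rho> y) * (\<Prod>b\<in>Basis. 1 + (y \<bullet> b)\<^sup>2) \<le> 2 ^ ?n * (C + C')" .
      moreover have "(\<Prod>b\<in>Basis. 1 + (y \<bullet> b)\<^sup>2) > 0"
        by (intro prod_pos) (auto simp: add_pos_nonneg)
      moreover have "(\<Prod>b\<in>Basis. inverse (1 + (y \<bullet> b)\<^sup>2)) = inverse (\<Prod>b\<in>Basis. 1 + (y \<bullet> b)\<^sup>2)"
        using prod_inversef[of "\<lambda>b. 1 + (y \<bullet> b)\<^sup>2" Basis] by (simp add: o_def)
      ultimately show ?thesis
        by (simp add: divide_inverse[symmetric] pos_le_divide_eq)
    qed
    then show "AE y in lborel. norm (norm y ^ k * norm (\<rho> y))
        \<le> norm (2 ^ ?n * (C + C') * (\<Prod>b\<in>Basis. inverse (1 + (y \<bullet> b)\<^sup>2)))"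
      by (intro AE_I2) (smt (verit) norm_ge_zero real_norm_def zero_le_mult_iff zero_le_power)
  qed measurable
qed simp

lemma rapid_gaussian:
  assumes "\<epsilon> > 0"
  shows "rapid (\<lambda>y::'a::euclidean_space. of_real (exp (- \<epsilon> * (norm y)\<^sup>2)))"
proof (rule rapidI)
  fix k
  have "norm y ^ k * norm (complex_of_real (exp (- \<epsilon> * (norm y)\<^sup>2))) \<le> 1 + fact k / \<epsilon> ^ k" for y :: 'a
  proof -
    define r where "r = norm y"
    have r: "r \<ge> 0" by (simp add: r_def)
    \<comment> \<open>Passing to powers of r^2 lets the exponential series in \<epsilon> r^2 supply
      the bound, for odd k as well.\<close>
    have "r ^ k \<le> 1 + (r\<^sup>2) ^ k"
    proof (cases "r \<le> 1")
      case True
      then show ?thesis using r power_le_one[of r k] by (smt (verit) zero_le_power zero_le_power2)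
    next
      case False
      then have "r ^ k \<le> (r\<^sup>2) ^ k"
        by (intro power_mono) (auto simp: power2_eq_square)
      then show ?thesis by simp
    qed
    then have "r ^ k * exp (- \<epsilon> * r\<^sup>2) \<le> (1 + (r\<^sup>2) ^ k) * exp (- \<epsilon> * r\<^sup>2)"
      by (intro mult_right_mono) auto
    also have "\<dots> = exp (- \<epsilon> * r\<^sup>2) + (r\<^sup>2) ^ k * exp (- \<epsilon> * r\<^sup>2)"
      by (simp add: algebra_simps)
    also have "\<dots> \<le> 1 + fact k / \<epsilon> ^ k"
    proof (intro add_mono)
      show "exp (- \<epsilon> * r\<^sup>2) \<le> 1" using assms by simp
      have "(\<epsilon> * r\<^sup>2) ^ k / fact k \<le> exp (\<epsilon> * r\<^sup>2)"
      proof -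
        have "(\<Sum>n\<in>{k}. (\<epsilon> * r\<^sup>2) ^ n /\<^sub>R fact n) \<le> (\<Sum>n. (\<epsilon> * r\<^sup>2) ^ n /\<^sub>R fact n)"
          by (rule sum_le_suminf) (use assms summable_exp_generic[of "\<epsilon> * r\<^sup>2"] in auto)
        then show ?thesis by (simp add: exp_def field_simps)
      qed
      then show "(r\<^sup>2) ^ k * exp (- \<epsilon> * r\<^sup>2) \<le> fact k / \<epsilon> ^ k"
        using assms by (simp add: exp_minus field_simps power_mult_distrib)
    qed
    finally show ?thesis by (simp add: r_def)
  qed
  then show "\<exists>C. \<forall>y::'a. norm y ^ k * norm (complex_of_real (exp (- \<epsilon> * (norm y)\<^sup>2))) \<le> C"
    by blast
qed measurable

section \<open>Translation invariance and integration by parts\<close>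

lemma lborel_integral_shift:
  fixes f :: "'a::euclidean_space \<Rightarrow> 'b::{banach, second_countable_topology}"
  assumes "integrable lborel f"
  shows "integrable lborel (\<lambda>y. f (y + c))" "(LINT y|lborel. f (y + c)) = (LINT y|lborel. f y)"
proof -
  have [measurable]: "f \<in> borel_measurable borel"
    using borel_measurable_integrable[OF assms] by simp
  have "integrable (distr lborel borel ((+) c)) f"
    using assms by (simp add: lborel_distr_plus)
  then show "integrable lborel (\<lambda>y. f (y + c))"
    by (simp add: integrable_distr_eq add.commute)
  have "(LINT y|lborel. f y) = (LINT y|distr lborel borel ((+) c). f y)"
    by (simp add: lborel_distr_plus)
  also have "\<dots> = (LINT y|lborel. f (y + c))"
    by (simp add: integral_distr add.commute)
  finally show "(LINT y|lborel. f (y + c)) = (LINT y|lborel. f y)" ..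
qed

text \<open>Integrating \<open>g (y + e) - g y = \<integral>\<^sub>0\<^sup>1 h (y + \<tau> e) d\<tau>\<close> over \<open>y\<close> gives
  \<open>0\<close> on the left and, by Fubini and translation invariance, \<open>\<integral> h\<close> on the right.
  This replaces a decay condition on \<open>g\<close> at infinity.\<close>

lemma integral_directional_derivative:
  fixes g h :: "'a::euclidean_space \<Rightarrow> complex"
  assumes deriv: "\<And>y \<tau>. ((\<lambda>\<tau>. g (y + \<tau> *\<^sub>R e)) has_vector_derivative h (y + \<tau> *\<^sub>R e)) (at \<tau>)"
    and cont: "continuous_on UNIV h" and g: "integrable lborel g" and h: "integrable lborel h"
  shows "(LINT y|lborel. h y) = 0"
proof -
  \<comment> \<open>The indicator extends the integral over [0,1] to the whole line, so that Fubini
    for a product of Lebesgue measures applies.\<close>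
  define F where "F = (\<lambda>(\<tau>::real, y). indicator {0..1} \<tau> *\<^sub>R h (y + \<tau> *\<^sub>R e))"
  have [measurable]: "h \<in> borel_measurable borel"
    using cont by (rule borel_measurable_continuous_onI)
  have ind: "integrable lborel (\<lambda>\<tau>::real. indicator {0..1} \<tau> * c)" for c :: real
    by (intro integrable_mult_left) (auto simp: integrable_indicator_iff)
  have "integrable (lborel \<Otimes>\<^sub>M lborel) F"
  proof (rule lborel_pair.Fubini_integrable)
    show "F \<in> borel_measurable (lborel \<Otimes>\<^sub>M lborel)"
      unfolding F_def by measurable
    have "(LINT y|lborel. norm (F (\<tau>, y))) = indicator {0..1} \<tau> * (LINT y|lborel. norm (h y))" for \<tau>
      using lborel_integral_shift(2)[OF integrable_norm[OF h], of "\<tau> *\<^sub>R e"] by (simp add: F_def)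
    then show "integrable lborel (\<lambda>\<tau>. LINT y|lborel. norm (F (\<tau>, y)))"
      using ind by simp
    show "AE \<tau> in lborel. integrable lborel (\<lambda>y. F (\<tau>, y))"
      unfolding F_def by (intro AE_I2) (auto intro!: integrable_scaleR_right lborel_integral_shift(1) h)
  qed
  then have "(LINT y|lborel. LINT \<tau>|lborel. F (\<tau>, y)) = (LINT \<tau>|lborel. LINT y|lborel. F (\<tau>, y))"
    by (intro lborel_pair.Fubini_integral) simp
  moreover have "(LINT \<tau>|lborel. F (\<tau>, y)) = g (y + e) - g y" for y
  proof -
    have "(LINT \<tau>|lborel. F (\<tau>, y)) = g (y + 1 *\<^sub>R e) - g (y + 0 *\<^sub>R e)"
      unfolding F_def prod.case
    proof (rule integral_FTC_atLeastAtMost)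
      show "continuous_on {0..1} (\<lambda>\<tau>. h (y + \<tau> *\<^sub>R e))"
        by (rule continuous_on_compose2[OF cont]) (auto intro!: continuous_intros)
    qed (auto intro: has_vector_derivative_at_within deriv)
    then show ?thesis by simp
  qed
  moreover have "(LINT y|lborel. g (y + e) - g y) = 0"
    using lborel_integral_shift[OF g, of e] g by simp
  moreover have "(LINT y|lborel. F (\<tau>, y)) = indicator {0..1} \<tau> *\<^sub>R (LINT y|lborel. h y)" for \<tau>
    using lborel_integral_shift(2)[OF h, of "\<tau> *\<^sub>R e"] by (simp add: F_def)
  ultimately show ?thesis by simp
qed

section \<open>The Gaussian integral with complex parameter\<close>

lemma osc_has_vector_derivative:
  fixes \<rho> :: "'a::euclidean_space \<Rightarrow> complex"
  assumes "rapid \<rho>" and a: "(a has_real_derivative a') (at t)"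
    and b: "(b has_vector_derivative b') (at t)"
  shows "((\<lambda>t. osc \<rho> (a t) (b t)) has_vector_derivative
    \<i> * (of_real a' * osc (\<lambda>y. of_real ((norm y)\<^sup>2) * \<rho> y) (a t) (b t)
        - (\<Sum>i\<in>Basis. of_real (b' \<bullet> i) * osc (\<lambda>y. of_real (y \<bullet> i) * \<rho> y) (a t) (b t)))) (at t)"
proof -
  have "((\<lambda>t. (a t, b t)) has_vector_derivative (a', b')) (at t)"
    using a b by (intro has_vector_derivative_Pair)
      (auto simp: has_real_derivative_iff_has_vector_derivative)
  from vector_derivative_diff_chain_within[OF this has_derivative_at_withinI[OF osc_has_derivative[OF assms(1)]]]
  show ?thesis by (simp add: o_def)
qed

lemma norm_sq_eq_sum: "(norm (y::'a::euclidean_space))\<^sup>2 = (\<Sum>j\<in>Basis. (y \<bullet> j)\<^sup>2)"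
  by (subst power2_norm_eq_inner, subst euclidean_inner) (simp add: power2_eq_square)

context
  fixes \<epsilon> a :: real and b :: "'a::euclidean_space" and \<rho> :: "'a \<Rightarrow> complex" and \<alpha> :: complex
  assumes \<epsilon>: "\<epsilon> > 0"
  defines "\<rho> \<equiv> \<lambda>y. of_real (exp (- \<epsilon> * (norm y)\<^sup>2))" and "\<alpha> \<equiv> Complex \<epsilon> (- a)"
begin

text \<open>The full integrand of the Gaussian \<open>osc\<close>. Merging the damping into the
  phase gives exp(-\<alpha>|y|^2 - i<b,y>) with \<alpha> = \<epsilon> - i a, whose directional
  derivatives are affine functions times \<open>q\<close>.\<close>

private definition q :: "'a \<Rightarrow> complex" where
  "q y = cis (a * (norm y)\<^sup>2 - b \<bullet> y) * \<rho> y"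

private lemma rapid_rho: "rapid \<rho>"
  unfolding \<rho>_def by (rule rapid_gaussian) (rule \<epsilon>)

private lemma q_eq: "q y = exp (- \<alpha> * of_real (y \<bullet> y) - \<i> * of_real (b \<bullet> y))"
proof -
  have \<alpha>: "\<alpha> = of_real \<epsilon> - \<i> * of_real a"
    by (simp add: \<alpha>_def complex_eq_iff)
  show ?thesis
    by (simp add: \<alpha> q_def \<rho>_def cis_conv_exp exp_of_real[symmetric] exp_add[symmetric]
        power2_norm_eq_inner algebra_simps del: exp_of_real)
qed

private lemma q_deriv:
  assumes "j \<in> Basis"
  shows "((\<lambda>\<tau>. q (y + \<tau> *\<^sub>R j)) has_vector_derivative
    (- 2 * \<alpha> * of_real ((y + \<tau> *\<^sub>R j) \<bullet> j) - \<i> * of_real (b \<bullet> j)) * q (y + \<tau> *\<^sub>R j)) (at \<tau>)"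
proof -
  have "((\<lambda>\<tau>. - \<alpha> * of_real ((y + \<tau> *\<^sub>R j) \<bullet> (y + \<tau> *\<^sub>R j)) - \<i> * of_real (b \<bullet> (y + \<tau> *\<^sub>R j)))
     has_vector_derivative
      - \<alpha> * of_real (2 * ((y + \<tau> *\<^sub>R j) \<bullet> j)) - \<i> * of_real (b \<bullet> j)) (at \<tau>)"
    by (intro has_vector_derivative_diff has_vector_derivative_mult_right has_vector_derivative_of_real)
       (use assms in \<open>auto intro!: derivative_eq_intros simp: inner_add_left inner_add_right inner_commute algebra_simps
         simp flip: has_real_derivative_iff_has_vector_derivative\<close>)
  from field_vector_diff_chain_at[OF this DERIV_exp]
  show ?thesis
    by (simp add: q_eq[abs_def] o_def algebra_simps)
qed

private lemma continuous_q: "continuous_on UNIV q"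
  unfolding q_eq[abs_def] by (intro continuous_intros)

private lemma integrable_q:
  assumes "rapid (\<lambda>y. p y * \<rho> y)"
  shows "integrable lborel (\<lambda>y. p y * q y)"
  using integrable_osc[OF rapid_integrable[OF assms], of a b] by (simp add: q_def mult_ac)

private lemma osc_eq_q: "osc (\<lambda>y. p y * \<rho> y) a b = (LINT y|lborel. p y * q y)"
  by (simp add: osc_def q_def mult_ac)

private lemma integrable_q0: "integrable lborel q"
  using integrable_q[of "\<lambda>_. 1"] rapid_rho by simp

private lemma rapid_coord:
  "j \<in> Basis \<Longrightarrow> rapid (\<lambda>y. of_real (y \<bullet> j) * \<rho> y)"
  "j \<in> Basis \<Longrightarrow> rapid (\<lambda>y. of_real ((y \<bullet> j)\<^sup>2) * \<rho> y)"
  using rapid_mult_coordinate[OF rapid_rho] 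
    rapid_mult_coordinate[OF rapid_mult_coordinate[OF rapid_rho]]
  by (simp_all add: power2_eq_square mult.assoc)

text \<open>The j-th derivative of \<open>q\<close>, which is (-2\<alpha> y_j - i b_j)
  \<open>q\<close>, has integral zero; this expresses the first moment through the integral
  itself.\<close>

lemma gaussian_moment_1_osc:
  assumes j: "j \<in> Basis"
  shows "2 * \<alpha> * osc (\<lambda>y. of_real (y \<bullet> j) * \<rho> y) a b = - \<i> * of_real (b \<bullet> j) * osc \<rho> a b"
proof -
  note i1 = integrable_q[OF rapid_coord(1)[OF j]]
  have eq: "(- 2 * \<alpha> * of_real (y \<bullet> j) - \<i> * of_real (b \<bullet> j)) * q y
    = (- 2 * \<alpha>) * (of_real (y \<bullet> j) * q y) - \<i> * of_real (b \<bullet> j) * q y" for y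
    by (simp add: algebra_simps)
  have "(LINT y|lborel. (- 2 * \<alpha> * of_real (y \<bullet> j) - \<i> * of_real (b \<bullet> j)) * q y) = 0"
  proof (rule integral_directional_derivative[OF q_deriv[OF j]])
    show "continuous_on UNIV (\<lambda>y. (- 2 * \<alpha> * of_real (y \<bullet> j) - \<i> * of_real (b \<bullet> j)) * q y)"
      by (intro continuous_intros continuous_q)
    show "integrable lborel (\<lambda>y. (- 2 * \<alpha> * of_real (y \<bullet> j) - \<i> * of_real (b \<bullet> j)) * q y)"
      unfolding eq by (intro Bochner_Integration.integrable_diff integrable_mult_right i1 integrable_q0)
  qed (rule integrable_q0)
  then have "(- 2 * \<alpha>) * (LINT y|lborel. of_real (y \<bullet> j) * q y)
      - \<i> * of_real (b \<bullet> j) * (LINT y|lborel. q y) = 0"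
    unfolding eq using i1 integrable_q0 by (subst (asm) Bochner_Integration.integral_diff) auto
  then show ?thesis
    unfolding osc_eq_q using osc_eq_q[of "\<lambda>_. 1"] by (simp add: algebra_simps neg_eq_iff_add_eq_0 eq_neg_iff_add_eq_0)
qed

text \<open>The same argument for y_j \<open>q\<close>, whose j-th derivative has the additional
  term \<open>q\<close>.\<close>

lemma gaussian_moment_2_osc:
  assumes j: "j \<in> Basis"
  shows "2 * \<alpha> * osc (\<lambda>y. of_real ((y \<bullet> j)\<^sup>2) * \<rho> y) a b
    = osc \<rho> a b - \<i> * of_real (b \<bullet> j) * osc (\<lambda>y. of_real (y \<bullet> j) * \<rho> y) a b"
proof -
  note i1 = integrable_q[OF rapid_coord(1)[OF j]] and i2 = integrable_q[OF rapid_coord(2)[OF j]]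
  define h where "h = (\<lambda>y. of_real (y \<bullet> j) * ((- 2 * \<alpha> * of_real (y \<bullet> j) - \<i> * of_real (b \<bullet> j)) * q y) + q y)"
  have eq: "h y = (- 2 * \<alpha>) * (of_real ((y \<bullet> j)\<^sup>2) * q y) - \<i> * of_real (b \<bullet> j) * (of_real (y \<bullet> j) * q y) + q y" for y
    by (simp add: h_def algebra_simps power2_eq_square)
  have "(LINT y|lborel. h y) = 0"
  proof (rule integral_directional_derivative)
    show "((\<lambda>\<tau>. of_real ((y + \<tau> *\<^sub>R j) \<bullet> j) * q (y + \<tau> *\<^sub>R j)) has_vector_derivative h (y + \<tau> *\<^sub>R j)) (at \<tau>)"
      for y \<tau>
    proof -
      have "((\<lambda>\<tau>. complex_of_real ((y + \<tau> *\<^sub>R j) \<bullet> j)) has_vector_derivative of_real 1) (at \<tau>)"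
        by (rule has_vector_derivative_of_real)
          (use j in \<open>auto intro!: derivative_eq_intros simp: inner_add_left
            simp flip: has_real_derivative_iff_has_vector_derivative\<close>)
      from has_vector_derivative_mult[OF this q_deriv[OF j, of y]]
      show ?thesis by (simp add: h_def)
    qed
    show "continuous_on UNIV h"
      unfolding h_def by (intro continuous_intros continuous_q)
    show "integrable lborel h"
      unfolding eq[abs_def]
      by (intro Bochner_Integration.integrable_diff Bochner_Integration.integrable_add
          integrable_mult_right i1 i2 integrable_q0)
  qed (rule i1)
  then have "(- 2 * \<alpha>) * (LINT y|lborel. of_real ((y \<bullet> j)\<^sup>2) * q y)
      - \<i> * of_real (b \<bullet> j) * (LINT y|lborel. of_real (y \<bullet> j) * q y) + (LINT y|lborel. q y) = 0"
    unfolding eq using i1 i2 integrable_q0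
    by (simp add: Bochner_Integration.integral_add Bochner_Integration.integral_diff)
  then show ?thesis
    unfolding osc_eq_q using osc_eq_q[of "\<lambda>_. 1"] by (simp add: algebra_simps)
qed

text \<open>Summing the second moments at b = 0 yields the differential equation in
  \<open>a\<close>, since differentiation in \<open>a\<close> multiplies the weight by i
  |y|^2.\<close>

lemma gaussian_norm_sq_osc:
  assumes "b = 0"
  shows "2 * \<alpha> * osc (\<lambda>y. of_real ((norm y)\<^sup>2) * \<rho> y) a b = of_nat DIM('a) * osc \<rho> a b"
proof -
  have "of_real ((norm y)\<^sup>2) * \<rho> y = (\<Sum>j\<in>Basis. of_real ((y \<bullet> j)\<^sup>2) * \<rho> y)" for y
    by (simp add: norm_power norm_sq_eq_sum sum_distrib_right)
  then have "osc (\<lambda>y. of_real ((norm y)\<^sup>2) * \<rho> y) a b = (\<Sum>j\<in>Basis. osc (\<lambda>y. of_real ((y \<bullet> j)\<^sup>2) * \<rho> y) a b)"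
    using integrable_osc[OF rapid_integrable[OF rapid_coord(2)]]
    by (simp add: osc_def sum_distrib_left Bochner_Integration.integral_sum)
  moreover have "2 * \<alpha> * osc (\<lambda>y. of_real ((y \<bullet> j)\<^sup>2) * \<rho> y) a b = osc \<rho> a b" if "j \<in> Basis" for j
    using gaussian_moment_2_osc[OF that] assms by simp
  ultimately show ?thesis
    by (simp add: sum_distrib_left)
qed

end

text \<open>Read off from the normal density of variance 1/(2\<epsilon>), whose total mass is
  one.\<close>

lemma has_bochner_integral_gaussian:
  assumes "\<epsilon> > 0"
  shows "has_bochner_integral lborel (\<lambda>x::real. exp (- \<epsilon> * x\<^sup>2)) (sqrt (pi / \<epsilon>))"
proof -
  define \<sigma> where "\<sigma> = sqrt (1 / (2 * \<epsilon>))"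
  have \<sigma>: "\<sigma> > 0" "\<sigma>\<^sup>2 = 1 / (2 * \<epsilon>)"
    using assms by (auto simp: \<sigma>_def)
  have "has_bochner_integral lborel (normal_density 0 \<sigma>) 1"
    using integrable_normal_density[OF \<sigma>(1)] integral_normal_density[OF \<sigma>(1)]
    by (metis has_bochner_integral_integrable)
  then have "has_bochner_integral lborel (\<lambda>x. sqrt (pi / \<epsilon>) * normal_density 0 \<sigma> x) (sqrt (pi / \<epsilon>) * 1)"
    by (intro has_bochner_integral_mult_right) auto
  moreover have "sqrt (pi / \<epsilon>) * normal_density 0 \<sigma> x = exp (- \<epsilon> * x\<^sup>2)" for x
  proof -
    have "normal_density 0 \<sigma> x = 1 / sqrt (pi / \<epsilon>) * exp (- \<epsilon> * x\<^sup>2)"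
      using assms by (simp add: normal_density_def \<sigma>(2) mult.commute)
    then show ?thesis using assms by simp
  qed
  ultimately show ?thesis by simp
qed

lemma integral_gaussian:
  assumes "\<epsilon> > 0"
  shows "(LINT y|lborel. exp (- \<epsilon> * (norm (y::'a::euclidean_space))\<^sup>2)) = sqrt (pi / \<epsilon>) ^ DIM('a)"
proof -
  have "(\<integral>\<^sup>+y. ennreal (exp (- \<epsilon> * (norm (y::'a))\<^sup>2)) \<partial>lborel)
      = (\<integral>\<^sup>+y. (\<Prod>j\<in>Basis. ennreal (exp (- \<epsilon> * ((y::'a) \<bullet> j)\<^sup>2))) \<partial>lborel)"
    by (simp add: prod_ennreal norm_sq_eq_sum sum_distrib_left exp_sum[symmetric])
  also have "\<dots> = (\<Prod>j\<in>(Basis :: 'a set). \<integral>\<^sup>+x. ennreal (exp (- \<epsilon> * x\<^sup>2)) \<partial>lborel)"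
    by (rule nn_integral_lborel_prod) auto
  also have "(\<integral>\<^sup>+x. ennreal (exp (- \<epsilon> * x\<^sup>2)) \<partial>lborel) = ennreal (sqrt (pi / \<epsilon>))"
    using has_bochner_integral_gaussian[OF assms]
    by (subst nn_integral_eq_integral) (auto simp: has_bochner_integral_iff)
  finally show ?thesis
    using assms by (subst integral_eq_nn_integral) (auto simp: ennreal_power)
qed


text \<open>Two linear differential equations are solved by exhibiting a product with zero
  derivative: the first moment gives the factor depending on \<open>b\<close>, and at b = 0 the
  second moment gives the power of the root. The constant is the real Gaussian integral at a = 0.
  Since Re \<alpha> = \<epsilon> > 0, the line of parameters never meets the branch cut of
  \<open>csqrt\<close>.\<close>

lemma gaussian_osc:
  fixes b :: "'a::euclidean_space"
  assumes "\<epsilon> > 0"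
  shows "osc (\<lambda>y. of_real (exp (- \<epsilon> * (norm y)\<^sup>2))) a b
    = (of_real (sqrt pi) / csqrt (Complex \<epsilon> (- a))) ^ DIM('a)
      * exp (- of_real ((norm b)\<^sup>2) / (4 * Complex \<epsilon> (- a)))"
proof -
  define \<rho> :: "'a \<Rightarrow> complex" where "\<rho> = (\<lambda>y. of_real (exp (- \<epsilon> * (norm y)\<^sup>2)))"
  define \<alpha> where "\<alpha> a = Complex \<epsilon> (- a)" for a
  let ?m = "DIM('a)"
  have rapid: "rapid \<rho>" unfolding \<rho>_def using assms by (rule rapid_gaussian)
  have \<alpha>: "\<alpha> a \<noteq> 0" "\<alpha> a \<notin> \<real>\<^sub>\<le>\<^sub>0" for a
    using assms by (auto simp: \<alpha>_def complex_eq_iff complex_nonpos_Reals_iff)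
  \<comment> \<open>The scaling parameter joins 0 to \<open>b\<close>; comparing t = 1 with t = 0
    isolates the dependence on \<open>b\<close>.\<close>
  have "\<exists>c. \<forall>t\<in>UNIV. osc \<rho> a (t *\<^sub>R b) * exp (of_real (t\<^sup>2) * of_real ((norm b)\<^sup>2) / (4 * \<alpha> a)) = c"
  proof (rule has_vector_derivative_zero_constant)
    fix t
    define E where "E t = exp (of_real (t\<^sup>2) * of_real ((norm b)\<^sup>2) / (4 * \<alpha> a))" for t
    have M: "osc (\<lambda>y. of_real (y \<bullet> j) * \<rho> y) a (t *\<^sub>R b) = - \<i> * of_real (t * (b \<bullet> j)) * osc \<rho> a (t *\<^sub>R b) / (2 * \<alpha> a)"
      if "j \<in> Basis" for j
      using gaussian_moment_1_osc[OF assms that, of a "t *\<^sub>R b"] \<alpha>(1)[of a]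
      by (simp add: \<rho>_def \<alpha>_def field_simps)
    have "(\<Sum>j\<in>Basis. of_real (b \<bullet> j) * osc (\<lambda>y. of_real (y \<bullet> j) * \<rho> y) a (t *\<^sub>R b))
        = (\<Sum>j\<in>Basis. of_real ((b \<bullet> j)\<^sup>2) * (- \<i> * of_real t * osc \<rho> a (t *\<^sub>R b) / (2 * \<alpha> a)))"
      by (intro sum.cong) (simp_all add: M power2_eq_square)
    also have "\<dots> = of_real ((norm b)\<^sup>2) * (- \<i> * of_real t * osc \<rho> a (t *\<^sub>R b) / (2 * \<alpha> a))"
      by (simp only: norm_sq_eq_sum of_real_sum sum_distrib_right)
    finally have "\<i> * (of_real 0 * osc (\<lambda>y. of_real ((norm y)\<^sup>2) * \<rho> y) a (t *\<^sub>R b)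
        - (\<Sum>j\<in>Basis. of_real (b \<bullet> j) * osc (\<lambda>y. of_real (y \<bullet> j) * \<rho> y) a (t *\<^sub>R b)))
        = - of_real t * of_real ((norm b)\<^sup>2) / (2 * \<alpha> a) * osc \<rho> a (t *\<^sub>R b)"
      by (simp only:) (simp add: field_simps \<alpha>)
    moreover have "((\<lambda>t. osc \<rho> a (t *\<^sub>R b)) has_vector_derivative
        \<i> * (of_real 0 * osc (\<lambda>y. of_real ((norm y)\<^sup>2) * \<rho> y) a (t *\<^sub>R b)
        - (\<Sum>j\<in>Basis. of_real (b \<bullet> j) * osc (\<lambda>y. of_real (y \<bullet> j) * \<rho> y) a (t *\<^sub>R b)))) (at t)"
      by (rule osc_has_vector_derivative[OF rapid]) (auto intro!: derivative_eq_intros)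
    ultimately have d: "((\<lambda>t. osc \<rho> a (t *\<^sub>R b)) has_vector_derivative
        - of_real t * of_real ((norm b)\<^sup>2) / (2 * \<alpha> a) * osc \<rho> a (t *\<^sub>R b)) (at t)"
      by simp
    have "((\<lambda>t. of_real (t\<^sup>2) * of_real ((norm b)\<^sup>2) / (4 * \<alpha> a)) has_vector_derivative
        of_real (2 * t) * of_real ((norm b)\<^sup>2) / (4 * \<alpha> a)) (at t)"
      by (intro has_vector_derivative_mult_left has_vector_derivative_divide has_vector_derivative_of_real)
        (auto intro!: derivative_eq_intros simp flip: has_real_derivative_iff_has_vector_derivative)
    from field_vector_diff_chain_at[OF this DERIV_exp]
    have e: "(E has_vector_derivative of_real t * of_real ((norm b)\<^sup>2) / (2 * \<alpha> a) * E t) (at t)"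
      by (simp add: E_def[abs_def] o_def)
    show "((\<lambda>t. osc \<rho> a (t *\<^sub>R b) * exp (of_real (t\<^sup>2) * of_real ((norm b)\<^sup>2) / (4 * \<alpha> a)))
        has_vector_derivative 0) (at t within UNIV)"
      using has_vector_derivative_mult[OF d e] by (simp add: E_def[abs_def] mult_ac)
  qed (simp, blast)
  then obtain c where c: "\<And>t. osc \<rho> a (t *\<^sub>R b) * exp (of_real (t\<^sup>2) * of_real ((norm b)\<^sup>2) / (4 * \<alpha> a)) = c"
    by blast
  have "osc \<rho> a b * exp (of_real ((norm b)\<^sup>2) / (4 * \<alpha> a)) = osc \<rho> a 0"
    using c[of 1] c[of 0] by simp
  then have osc_b: "osc \<rho> a b = osc \<rho> a 0 * exp (- of_real ((norm b)\<^sup>2) / (4 * \<alpha> a))"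
    by (simp add: exp_minus field_simps)
  have "\<exists>c. \<forall>a\<in>UNIV. osc \<rho> a 0 * csqrt (\<alpha> a) ^ ?m = c"
  proof (rule has_vector_derivative_zero_constant)
    fix a
    have [simp]: "csqrt (\<alpha> a) \<noteq> 0" using \<alpha>(1) by simp
    have "osc (\<lambda>y. of_real ((norm y)\<^sup>2) * \<rho> y) a 0 = of_nat ?m * osc \<rho> a 0 / (2 * \<alpha> a)"
      using gaussian_norm_sq_osc[OF assms, of "0::'a" a] \<alpha>(1)[of a]
      by (simp add: \<rho>_def \<alpha>_def field_simps)
    moreover have "((\<lambda>a. osc \<rho> a 0) has_vector_derivative
        \<i> * (of_real 1 * osc (\<lambda>y. of_real ((norm y)\<^sup>2) * \<rho> y) a 0
        - (\<Sum>j\<in>Basis. of_real (0 \<bullet> j) * osc (\<lambda>y. of_real (y \<bullet> j) * \<rho> y) a 0))) (at a)"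
      by (rule osc_has_vector_derivative[OF rapid]) (auto intro!: derivative_eq_intros)
    ultimately have d: "((\<lambda>a. osc \<rho> a 0) has_vector_derivative
        \<i> * of_nat ?m / (2 * \<alpha> a) * osc \<rho> a 0) (at a)"
      by (simp add: mult.assoc)
    have "((\<lambda>a. of_real \<epsilon> - \<i> * of_real a) has_vector_derivative 0 - \<i> * of_real 1) (at a)"
      by (intro has_vector_derivative_diff has_vector_derivative_const
          has_vector_derivative_mult_right has_vector_derivative_of_real)
        (auto simp flip: has_real_derivative_iff_has_vector_derivative)
    moreover have "\<alpha> = (\<lambda>a. of_real \<epsilon> - \<i> * of_real a)"
      by (auto simp: \<alpha>_def complex_eq_iff)
    ultimately have "(\<alpha> has_vector_derivative - \<i>) (at a)"
      by simp
    moreover have "((\<lambda>z. csqrt z ^ ?m) has_field_derivative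
        of_nat ?m * (1 / (2 * csqrt (\<alpha> a)) * csqrt (\<alpha> a) ^ (?m - Suc 0))) (at (\<alpha> a))"
      using \<alpha>(2) by (auto intro!: derivative_eq_intros)
    ultimately have "((\<lambda>a. csqrt (\<alpha> a) ^ ?m) has_vector_derivative
        - \<i> * (of_nat ?m * (1 / (2 * csqrt (\<alpha> a)) * csqrt (\<alpha> a) ^ (?m - Suc 0)))) (at a)"
      by (auto dest: field_vector_diff_chain_at simp: o_def)
    also have "- \<i> * (of_nat ?m * (1 / (2 * csqrt (\<alpha> a)) * csqrt (\<alpha> a) ^ (?m - Suc 0)))
       = - \<i> * of_nat ?m / (2 * (csqrt (\<alpha> a))\<^sup>2) * csqrt (\<alpha> a) ^ Suc (?m - Suc 0)"
    proof -
      have "- \<i> * (n * (1 / (2 * c) * c ^ k)) = - \<i> * n / (2 * c\<^sup>2) * c ^ Suc k"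
        if "c \<noteq> 0" for n c :: complex and k
        using that by (simp add: power2_eq_square field_simps)
      then show ?thesis by this (simp add: \<alpha>)
    qed
    \<comment> \<open>Truncated subtraction is harmless here because the dimension is
      positive.\<close>
    also have "Suc (?m - Suc 0) = ?m" by simp
    finally have e: "((\<lambda>a. csqrt (\<alpha> a) ^ ?m) has_vector_derivative
        - \<i> * of_nat ?m / (2 * \<alpha> a) * csqrt (\<alpha> a) ^ ?m) (at a)"
      by simp
    show "((\<lambda>a. osc \<rho> a 0 * csqrt (\<alpha> a) ^ ?m) has_vector_derivative 0) (at a within UNIV)"
      by (rule has_vector_derivative_at_within, rule has_vector_derivative_eq_rhs[OF has_vector_derivative_mult[OF d e]]) (simp add: mult_ac)
  qed (simp, blast)
  then obtain c' where c': "\<And>a. osc \<rho> a 0 * csqrt (\<alpha> a) ^ ?m = c'"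
    by blast
  have Complex_of_real: "Complex \<epsilon> 0 = of_real \<epsilon>"
    by (simp add: complex_eq_iff)
  have "osc \<rho> 0 0 = of_real (LINT y|lborel. exp (- \<epsilon> * (norm (y::'a))\<^sup>2))"
    unfolding osc_def \<rho>_def by (simp flip: integral_complex_of_real)
  also have "\<dots> = of_real (sqrt (pi / \<epsilon>) ^ ?m)"
    by (simp only: integral_gaussian[OF assms])
  finally have "c' = of_real (sqrt (pi / \<epsilon>) ^ ?m) * csqrt (of_real \<epsilon>) ^ ?m"
    using c'[of 0] by (simp add: \<alpha>_def Complex_of_real)
  also have "\<dots> = of_real ((sqrt (pi / \<epsilon>) * sqrt \<epsilon>) ^ ?m)"
    using assms by (simp only: csqrt_of_real less_imp_le of_real_mult of_real_power power_mult_distrib)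
  also have "sqrt (pi / \<epsilon>) * sqrt \<epsilon> = sqrt pi"
    using assms by (simp add: real_sqrt_divide)
  finally have "osc \<rho> a 0 * csqrt (\<alpha> a) ^ ?m = of_real (sqrt pi ^ ?m)"
    using c' by metis
  moreover have "csqrt (\<alpha> a) ^ ?m \<noteq> 0"
    using \<alpha>(1)[of a] by simp
  ultimately have "osc \<rho> a 0 = (of_real (sqrt pi) / csqrt (\<alpha> a)) ^ ?m"
    unfolding power_divide of_real_power by (subst nonzero_eq_divide_eq)
  then show ?thesis
    unfolding \<rho>_def[symmetric] \<alpha>_def[symmetric] osc_b by (rule arg_cong)
qed

section \<open>Free evolution and Fourier inversion\<close>

lemma lborel_integral_affine:
  fixes f :: "'a::euclidean_space \<Rightarrow> complex"
  assumes [measurable]: "f \<in> borel_measurable borel" and "c > 0"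
  shows "(LINT y|lborel. f y) = of_real (c ^ DIM('a)) * (LINT w|lborel. f (z + c *\<^sub>R w))"
proof -
  have "(LINT y|lborel. f y) = (LINT y|density (distr lborel borel (\<lambda>x. z + c *\<^sub>R x)) (\<lambda>_. ennreal (\<bar>c\<bar> ^ DIM('a))). f y)"
    using lborel_affine[of c z] assms(2) by simp
  also have "\<dots> = (LINT y|distr lborel borel (\<lambda>x. z + c *\<^sub>R x). (\<bar>c\<bar> ^ DIM('a)) *\<^sub>R f y)"
    by (intro integral_density) auto
  also have "\<dots> = (LINT w|lborel. (\<bar>c\<bar> ^ DIM('a)) *\<^sub>R f (z + c *\<^sub>R w))"
    by (intro integral_distr) auto
  finally show ?thesis
    using assms(2) by (simp add: scaleR_conv_of_real)
qed

text \<open>The damping exp(-\<epsilon>|\<xi>|^2) makes the double integral absolutely convergent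
  for merely integrable \<psi>, so Fubini applies. The inner integral in \<xi> is the complex
  Gaussian with parameter \<epsilon> + i s at y - z.\<close>

lemma osc_gaussian_osc:
  fixes \<psi> :: "'a::euclidean_space \<Rightarrow> complex"
  assumes \<psi>: "integrable lborel \<psi>" and \<epsilon>: "\<epsilon> > 0"
  shows "osc (\<lambda>\<xi>. of_real (exp (- \<epsilon> * (norm \<xi>)\<^sup>2)) * osc \<psi> 0 \<xi>) (- s) (- z)
    = (of_real (sqrt pi) / csqrt (Complex \<epsilon> s)) ^ DIM('a)
      * (LINT y|lborel. exp (- of_real ((norm (y - z))\<^sup>2) / (4 * Complex \<epsilon> s)) * \<psi> y)"
proof -
  define g :: "'a \<Rightarrow> complex" where "g = (\<lambda>\<xi>. of_real (exp (- \<epsilon> * (norm \<xi>)\<^sup>2)))"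
  have g: "integrable lborel g"
    unfolding g_def by (intro rapid_integrable rapid_gaussian \<epsilon>)
  have [measurable]: "\<psi> \<in> borel_measurable borel" "g \<in> borel_measurable borel"
    using borel_measurable_integrable[OF \<psi>] borel_measurable_integrable[OF g] by simp_all
  define F where "F = (\<lambda>(\<xi>, y). cis (- s * (norm \<xi>)\<^sup>2 - (- z) \<bullet> \<xi>) * (g \<xi> * (cis (0 * (norm y)\<^sup>2 - \<xi> \<bullet> y) * \<psi> y)))"
  have "integrable (lborel \<Otimes>\<^sub>M lborel) F"
  proof (rule lborel_pair.Fubini_integrable)
    show "F \<in> borel_measurable (lborel \<Otimes>\<^sub>M lborel)"
      unfolding F_def cis_conv_exp by measurable
    have "(LINT y|lborel. norm (F (\<xi>, y))) = norm (g \<xi>) * (LINT y|lborel. norm (\<psi> y))" for \<xi>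
      by (simp add: F_def norm_mult)
    then show "integrable lborel (\<lambda>\<xi>. LINT y|lborel. norm (F (\<xi>, y)))"
      using g by simp
    show "AE \<xi> in lborel. integrable lborel (\<lambda>y. F (\<xi>, y))"
      unfolding F_def prod.case
      by (intro AE_I2 integrable_mult_right integrable_osc \<psi>)
  qed
  then have "(LINT \<xi>|lborel. LINT y|lborel. F (\<xi>, y)) = (LINT y|lborel. LINT \<xi>|lborel. F (\<xi>, y))"
    by (intro lborel_pair.Fubini_integral[symmetric]) simp
  moreover have "osc (\<lambda>\<xi>. g \<xi> * osc \<psi> 0 \<xi>) (- s) (- z) = (LINT \<xi>|lborel. LINT y|lborel. F (\<xi>, y))"
    by (simp add: osc_def F_def)
  moreover have "(LINT \<xi>|lborel. F (\<xi>, y)) = osc g (- s) (y - z) * \<psi> y" for y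
  proof -
    have "cis (- s * (norm \<xi>)\<^sup>2 - (y - z) \<bullet> \<xi>)
        = cis (- s * (norm \<xi>)\<^sup>2 - (- z) \<bullet> \<xi>) * cis (0 * (norm y)\<^sup>2 - \<xi> \<bullet> y)" for \<xi>
      unfolding cis_mult by (simp add: inner_diff_left inner_commute[of \<xi>] algebra_simps)
    then have "F (\<xi>, y) = cis (- s * (norm \<xi>)\<^sup>2 - (y - z) \<bullet> \<xi>) * g \<xi> * \<psi> y" for \<xi>
      by (simp add: F_def mult_ac)
    then show ?thesis by (simp add: osc_def)
  qed
  moreover have "osc g (- s) (y - z) = (of_real (sqrt pi) / csqrt (Complex \<epsilon> s)) ^ DIM('a)
      * exp (- of_real ((norm (y - z))\<^sup>2) / (4 * Complex \<epsilon> s))" for y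
    using gaussian_osc[OF \<epsilon>, of "- s" "y - z"] by (simp add: g_def)
  ultimately show ?thesis
    by (simp add: g_def mult.assoc)
qed

context
  fixes \<psi> :: "'a::euclidean_space \<Rightarrow> complex"
  assumes \<psi>: "integrable lborel \<psi>" and hat: "integrable lborel (osc \<psi> 0)"
begin

private lemma measurable_psi [measurable]: "\<psi> \<in> borel_measurable borel"
  using borel_measurable_integrable[OF \<psi>] by simp

private lemma measurable_hat [measurable]: "osc \<psi> 0 \<in> borel_measurable borel"
  using borel_measurable_integrable[OF hat] by simp

text \<open>The damping is removed on the Fourier side with |\<open>osc \<psi> 0\<close>| as
  majorant. No sign is imposed on s: positive s leads to the Schroedinger kernel, s = 0 to Fourier
  inversion.\<close>

private lemma osc_gaussian_osc_limit:
  "(\<lambda>n. osc (\<lambda>\<xi>. of_real (exp (- inverse (real (Suc n)) * (norm \<xi>)\<^sup>2)) * osc \<psi> 0 \<xi>) (- s) (- z))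
    \<longlonglongrightarrow> osc (osc \<psi> 0) (- s) (- z)"
  unfolding osc_def[of _ "- s"]
proof (rule integral_dominated_convergence[where w = "\<lambda>\<xi>. norm (osc \<psi> 0 \<xi>)"])
  show "AE \<xi> in lborel. (\<lambda>n. cis (- s * (norm \<xi>)\<^sup>2 - - z \<bullet> \<xi>)
      * (of_real (exp (- inverse (real (Suc n)) * (norm \<xi>)\<^sup>2)) * osc \<psi> 0 \<xi>))
      \<longlonglongrightarrow> cis (- s * (norm \<xi>)\<^sup>2 - - z \<bullet> \<xi>) * osc \<psi> 0 \<xi>"
  proof (rule AE_I2)
    fix \<xi>
    have "(\<lambda>n. cis (- s * (norm \<xi>)\<^sup>2 - - z \<bullet> \<xi>)
      * (of_real (exp (- inverse (real (Suc n)) * (norm \<xi>)\<^sup>2)) * osc \<psi> 0 \<xi>))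
      \<longlonglongrightarrow> cis (- s * (norm \<xi>)\<^sup>2 - - z \<bullet> \<xi>) * (of_real (exp (- 0 * (norm \<xi>)\<^sup>2)) * osc \<psi> 0 \<xi>)"
      by (intro tendsto_intros LIMSEQ_inverse_real_of_nat)
    then show "(\<lambda>n. cis (- s * (norm \<xi>)\<^sup>2 - - z \<bullet> \<xi>)
      * (of_real (exp (- inverse (real (Suc n)) * (norm \<xi>)\<^sup>2)) * osc \<psi> 0 \<xi>))
      \<longlonglongrightarrow> cis (- s * (norm \<xi>)\<^sup>2 - - z \<bullet> \<xi>) * osc \<psi> 0 \<xi>"
      by simp
  qed
  show "(\<lambda>\<xi>. cis (- s * (norm \<xi>)\<^sup>2 - - z \<bullet> \<xi>) * osc \<psi> 0 \<xi>) \<in> borel_measurable lborel"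
    unfolding cis_conv_exp by measurable
  show "(\<lambda>\<xi>. cis (- s * (norm \<xi>)\<^sup>2 - - z \<bullet> \<xi>)
      * (of_real (exp (- inverse (real (Suc n)) * (norm \<xi>)\<^sup>2)) * osc \<psi> 0 \<xi>)) \<in> borel_measurable lborel" for n
    unfolding cis_conv_exp by measurable
  show "AE \<xi> in lborel. norm (cis (- s * (norm \<xi>)\<^sup>2 - - z \<bullet> \<xi>)
      * (of_real (exp (- inverse (real (Suc n)) * (norm \<xi>)\<^sup>2)) * osc \<psi> 0 \<xi>)) \<le> norm (osc \<psi> 0 \<xi>)" for n
    by (intro AE_I2) (simp add: norm_mult mult_left_le_one_le)
qed (simp add: hat)

text \<open>Both sides of the damped identity converge as the damping vanishes, and the limits must
  agree. On the kernel side the exponent has nonpositive real part, so |\<psi>| is a majorant; s > 0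
  keeps the kernel away from its singularity and i s off the branch cut of the root.\<close>

lemma osc_osc:
  assumes s: "s > 0"
  shows "osc (osc \<psi> 0) (- s) (- z) = (of_real (sqrt pi) / csqrt (\<i> * of_real s)) ^ DIM('a)
      * (LINT y|lborel. cis ((norm (y - z))\<^sup>2 / (4 * s)) * \<psi> y)"
proof (rule LIMSEQ_unique[OF osc_gaussian_osc_limit])
  define \<alpha> where "\<alpha> n = Complex (inverse (real (Suc n))) s" for n
  have \<alpha>: "\<alpha> \<longlonglongrightarrow> \<i> * of_real s"
    using tendsto_Complex[OF LIMSEQ_inverse_real_of_nat tendsto_const[of s]]
    by (simp add: \<alpha>_def[abs_def] complex_eq_iff Complex_eq)
  have lim: "(\<lambda>n. LINT y|lborel. exp (- of_real ((norm (y - z))\<^sup>2) / (4 * \<alpha> n)) * \<psi> y)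
      \<longlonglongrightarrow> (LINT y|lborel. cis ((norm (y - z))\<^sup>2 / (4 * s)) * \<psi> y)"
  proof (rule integral_dominated_convergence[where w = "\<lambda>y. norm (\<psi> y)"])
    show "AE y in lborel. (\<lambda>n. exp (- of_real ((norm (y - z))\<^sup>2) / (4 * \<alpha> n)) * \<psi> y)
        \<longlonglongrightarrow> cis ((norm (y - z))\<^sup>2 / (4 * s)) * \<psi> y"
    proof (rule AE_I2)
      fix y
      have "(\<lambda>n. exp (- of_real ((norm (y - z))\<^sup>2) / (4 * \<alpha> n)) * \<psi> y)
        \<longlonglongrightarrow> exp (- of_real ((norm (y - z))\<^sup>2) / (4 * (\<i> * of_real s))) * \<psi> y"
        using s by (intro tendsto_intros \<alpha>) auto
      moreover have "exp (- of_real ((norm (y - z))\<^sup>2) / (4 * (\<i> * of_real s))) = cis ((norm (y - z))\<^sup>2 / (4 * s))"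
      proof -
        have "- of_real ((norm (y - z))\<^sup>2) / (4 * (\<i> * of_real s)) = \<i> * of_real ((norm (y - z))\<^sup>2 / (4 * s))"
          using s by (simp add: divide_simps)
        then show ?thesis by (simp only: cis_conv_exp)
      qed
      ultimately show "(\<lambda>n. exp (- of_real ((norm (y - z))\<^sup>2) / (4 * \<alpha> n)) * \<psi> y)
        \<longlonglongrightarrow> cis ((norm (y - z))\<^sup>2 / (4 * s)) * \<psi> y" by simp
    qed
    show "(\<lambda>y. cis ((norm (y - z))\<^sup>2 / (4 * s)) * \<psi> y) \<in> borel_measurable lborel"
      unfolding cis_conv_exp by measurable
    show "AE y in lborel. norm (exp (- of_real ((norm (y - z))\<^sup>2) / (4 * \<alpha> n)) * \<psi> y) \<le> norm (\<psi> y)" for n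
    proof (rule AE_I2)
      fix y
      have "Re (- of_real ((norm (y - z))\<^sup>2) / (4 * \<alpha> n)) \<le> 0"
        by (simp add: \<alpha>_def Re_divide zero_le_mult_iff divide_nonpos_nonneg)
      then have "norm (exp (- of_real ((norm (y - z))\<^sup>2) / (4 * \<alpha> n))) \<le> 1"
        by simp
      then show "norm (exp (- of_real ((norm (y - z))\<^sup>2) / (4 * \<alpha> n)) * \<psi> y) \<le> norm (\<psi> y)"
        unfolding norm_mult by (intro mult_left_le_one_le) auto
    qed
  qed (auto simp: \<psi>)
  have "\<i> * complex_of_real s \<notin> \<real>\<^sub>\<le>\<^sub>0"
    using s by (auto simp: complex_nonpos_Reals_iff)
  then have "isCont csqrt (\<i> * of_real s)"
    by (rule continuous_at_csqrt)
  then have "(\<lambda>n. csqrt (\<alpha> n)) \<longlonglongrightarrow> csqrt (\<i> * of_real s)"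
    using \<alpha> by (rule isCont_tendsto_compose)
  then have "(\<lambda>n. (of_real (sqrt pi) / csqrt (\<alpha> n)) ^ DIM('a)
      * (LINT y|lborel. exp (- of_real ((norm (y - z))\<^sup>2) / (4 * \<alpha> n)) * \<psi> y))
      \<longlonglongrightarrow> (of_real (sqrt pi) / csqrt (\<i> * of_real s)) ^ DIM('a)
      * (LINT y|lborel. cis ((norm (y - z))\<^sup>2 / (4 * s)) * \<psi> y)"
    using s by (intro tendsto_intros lim) auto
  then show "(\<lambda>n. osc (\<lambda>\<xi>. of_real (exp (- inverse (real (Suc n)) * (norm \<xi>)\<^sup>2)) * osc \<psi> 0 \<xi>) (- s) (- z))
    \<longlonglongrightarrow> (of_real (sqrt pi) / csqrt (\<i> * of_real s)) ^ DIM('a)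
      * (LINT y|lborel. cis ((norm (y - z))\<^sup>2 / (4 * s)) * \<psi> y)"
    by (subst osc_gaussian_osc[OF \<psi>]) (simp_all add: \<alpha>_def)
qed

text \<open>At s = 0 the kernel is a Gaussian of width proportional to sqrt \<epsilon>. Substituting
  y = z + 2 sqrt(\<epsilon>) w makes its weight independent of \<epsilon>, and continuity and
  boundedness of \<psi> give the limit. The factors (2 sqrt pi)^m from the scaling and (sqrt pi)^m
  from the Gaussian integral multiply to (2 pi)^m.\<close>

lemma fourier_inversion:
  assumes cont: "continuous_on UNIV \<psi>" and bounded: "\<And>y. norm (\<psi> y) \<le> B"
  shows "osc (osc \<psi> 0) 0 (- z) = of_real ((2 * pi) ^ DIM('a)) * \<psi> z"
proof -
  let ?m = "DIM('a)"
  define \<epsilon> where "\<epsilon> n = inverse (real (Suc n))" for n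
  have \<epsilon>: "\<epsilon> n > 0" "\<epsilon> \<longlonglongrightarrow> 0" for n
    using LIMSEQ_inverse_real_of_nat by (simp_all add: \<epsilon>_def[abs_def])
  have gauss: "integrable lborel (\<lambda>w::'a. exp (- (norm w)\<^sup>2))"
    using integrable_norm[OF rapid_integrable[OF rapid_gaussian[of 1]]] by simp
  \<comment> \<open>The literal \<open>- 0\<close> matches the instance s = 0 of the damped identity
    and of its limit.\<close>
  have eq: "osc (\<lambda>\<xi>. of_real (exp (- \<epsilon> n * (norm \<xi>)\<^sup>2)) * osc \<psi> 0 \<xi>) (- 0) (- z)
      = of_real ((2 * sqrt pi) ^ ?m)
        * (LINT w|lborel. of_real (exp (- (norm w)\<^sup>2)) * \<psi> (z + (2 * sqrt (\<epsilon> n)) *\<^sub>R w))" for n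
  proof -
    have c: "2 * sqrt (\<epsilon> n) > 0" using \<epsilon>(1)[of n] by simp
    have ce: "Complex (\<epsilon> n) 0 = of_real (\<epsilon> n)" by (simp add: complex_eq_iff)
    have cs: "csqrt (of_real (\<epsilon> n)) = of_real (sqrt (\<epsilon> n))"
      using \<epsilon>(1)[of n] by (intro csqrt_of_real) simp
    have "- complex_of_real ((norm ((2 * sqrt (\<epsilon> n)) *\<^sub>R w))\<^sup>2) / (4 * of_real (\<epsilon> n)) = of_real (- (norm w)\<^sup>2)" for w :: 'a
    proof -
      have "(norm ((2 * sqrt (\<epsilon> n)) *\<^sub>R w))\<^sup>2 = 4 * \<epsilon> n * (norm w)\<^sup>2"
        using \<epsilon>(1)[of n] by (simp add: power_mult_distrib)
      then show ?thesis using \<epsilon>(1)[of n] by simp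
    qed
    then have "exp (- complex_of_real ((norm ((2 * sqrt (\<epsilon> n)) *\<^sub>R w))\<^sup>2) / (4 * of_real (\<epsilon> n))) = of_real (exp (- (norm w)\<^sup>2))" for w :: 'a
      by (simp only: exp_of_real)
    then have "osc (\<lambda>\<xi>. of_real (exp (- \<epsilon> n * (norm \<xi>)\<^sup>2)) * osc \<psi> 0 \<xi>) (- 0) (- z)
      = (of_real (sqrt pi) / of_real (sqrt (\<epsilon> n))) ^ ?m * (of_real ((2 * sqrt (\<epsilon> n)) ^ ?m)
        * (LINT w|lborel. of_real (exp (- (norm w)\<^sup>2)) * \<psi> (z + (2 * sqrt (\<epsilon> n)) *\<^sub>R w)))"
      unfolding osc_gaussian_osc[OF \<psi> \<epsilon>(1)] ce cs
      by (subst lborel_integral_affine[OF _ c, of _ z]) simp_all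
    also have "(of_real (sqrt pi) / of_real (sqrt (\<epsilon> n))) ^ ?m * (of_real ((2 * sqrt (\<epsilon> n)) ^ ?m) * I)
        = of_real ((2 * sqrt pi) ^ ?m) * I" for I :: complex
      using \<epsilon>(1)[of n] by (simp add: power_divide power_mult_distrib)
    finally show ?thesis .
  qed
  have "(\<lambda>n. LINT w|lborel. of_real (exp (- (norm w)\<^sup>2)) * \<psi> (z + (2 * sqrt (\<epsilon> n)) *\<^sub>R w))
      \<longlonglongrightarrow> (LINT w|lborel. of_real (exp (- (norm (w::'a))\<^sup>2)) * \<psi> z)"
  proof (rule integral_dominated_convergence[where w = "\<lambda>w. B * exp (- (norm w)\<^sup>2)"])
    show "AE w in lborel. (\<lambda>n. of_real (exp (- (norm w)\<^sup>2)) * \<psi> (z + (2 * sqrt (\<epsilon> n)) *\<^sub>R w))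
        \<longlonglongrightarrow> of_real (exp (- (norm w)\<^sup>2)) * \<psi> z"
    proof (rule AE_I2)
      fix w
      have "(\<lambda>n. z + (2 * sqrt (\<epsilon> n)) *\<^sub>R w) \<longlonglongrightarrow> z + (2 * sqrt 0) *\<^sub>R w"
        by (intro tendsto_intros \<epsilon>)
      moreover have "isCont \<psi> z"
        using cont by (simp add: continuous_on_eq_continuous_at)
      ultimately have "(\<lambda>n. \<psi> (z + (2 * sqrt (\<epsilon> n)) *\<^sub>R w)) \<longlonglongrightarrow> \<psi> z"
        by (intro isCont_tendsto_compose[of z \<psi>]) simp_all
      then show "(\<lambda>n. of_real (exp (- (norm w)\<^sup>2)) * \<psi> (z + (2 * sqrt (\<epsilon> n)) *\<^sub>R w))
        \<longlonglongrightarrow> of_real (exp (- (norm w)\<^sup>2)) * \<psi> z"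
        by (intro tendsto_intros)
    qed
    show "AE w in lborel. norm (of_real (exp (- (norm w)\<^sup>2)) * \<psi> (z + (2 * sqrt (\<epsilon> n)) *\<^sub>R w))
        \<le> B * exp (- (norm w)\<^sup>2)" for n
      using bounded by (intro AE_I2) (simp add: norm_mult mult.commute)
  qed (use gauss in auto)
  also have "(LINT w|lborel. of_real (exp (- (norm (w::'a))\<^sup>2)) * \<psi> z) = of_real (sqrt pi ^ ?m) * \<psi> z"
  proof -
    have "(LINT w|lborel. complex_of_real (exp (- (norm (w::'a))\<^sup>2))) = of_real (sqrt pi ^ ?m)"
      using integral_gaussian[of 1, where 'a = 'a] by (subst integral_complex_of_real) simp
    then show ?thesis by simp
  qed
  finally have "(\<lambda>n. of_real ((2 * sqrt pi) ^ ?m)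
      * (LINT w|lborel. of_real (exp (- (norm w)\<^sup>2)) * \<psi> (z + (2 * sqrt (\<epsilon> n)) *\<^sub>R w)))
      \<longlonglongrightarrow> of_real ((2 * sqrt pi) ^ ?m) * (of_real (sqrt pi ^ ?m) * \<psi> z)"
    by (intro tendsto_intros)
  then have "osc (osc \<psi> 0) (- 0) (- z) = of_real ((2 * sqrt pi) ^ ?m) * (of_real (sqrt pi ^ ?m) * \<psi> z)"
    using osc_gaussian_osc_limit[of 0 z] unfolding eq[symmetric] unfolding \<epsilon>_def
    by (intro LIMSEQ_unique)
  also have "\<dots> = of_real ((2 * sqrt pi * sqrt pi) ^ ?m) * \<psi> z"
    by (simp add: power_mult_distrib)
  also have "2 * sqrt pi * sqrt pi = 2 * pi" by simp
  finally show ?thesis by simp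
qed

end

section \<open>Schwartz functions\<close>

lemma Basis_vec_real: "(Basis :: (real^'m::finite) set) = range (\<lambda>j. axis j 1)"
  by (auto simp: Basis_vec_def)

lemma inj_axis_1: "inj (\<lambda>j::'m::finite. axis j (1::real))"
  by (auto simp: inj_on_def axis_eq_axis)

lemma sum_Basis_vec: "(\<Sum>b\<in>Basis. f b) = (\<Sum>j\<in>UNIV. f (axis (j::'m::finite) (1::real)))"
  unfolding Basis_vec_real by (simp add: sum.reindex[OF inj_axis_1])

lemma prod_Basis_vec: "(\<Prod>b\<in>Basis. f b) = (\<Prod>j\<in>UNIV. f (axis (j::'m::finite) (1::real)))"
  unfolding Basis_vec_real by (simp add: prod.reindex[OF inj_axis_1])

lemma partial_eqI: "(g has_derivative D) (at x) \<Longrightarrow> partial i g x = D (axis i 1)"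
  unfolding partial_def by (metis frechet_derivative_at)

text \<open>In \<open>partials\<close> the last entry of the list acts first, so differentiating
  beforehand appends an entry on the right.\<close>

lemma schwartz_partial:
  assumes "g \<in> schwartz_space" shows "partial j g \<in> schwartz_space"
proof -
  have "partials ks (partial j g) = partials (ks @ [j]) g" for ks
    by (simp add: partials_def)
  then show ?thesis
    using assms by (auto simp: schwartz_space_def smooth_def)
qed

lemma schwartz_differentiable: "g \<in> schwartz_space \<Longrightarrow> g differentiable (at x)"
  unfolding schwartz_space_def smooth_def partials_def
  by (auto dest: spec[of _ "[]"])

lemma schwartz_continuous: "g \<in> schwartz_space \<Longrightarrow> continuous_on UNIV g"
  by (intro continuous_at_imp_continuous_on ballI differentiable_imp_continuous_within
      schwartz_differentiable)

lemma schwartz_bounded: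
  assumes "g \<in> schwartz_space"
  shows "\<exists>C. \<forall>y. norm y ^ k * norm (g y) \<le> C"
proof -
  have "bounded (range (\<lambda>x. norm x ^ k *\<^sub>R partials [] g x))"
    using assms by (auto simp: schwartz_space_def)
  then show ?thesis
    by (auto simp: bounded_iff partials_def)
qed

lemma schwartz_rapid:
  assumes "g \<in> schwartz_space" shows "rapid g"
  by (intro rapidI schwartz_bounded assms borel_measurable_continuous_onI schwartz_continuous)

lemma schwartz_directional:
  assumes "g \<in> schwartz_space"
  shows "((\<lambda>\<tau>. g (y + \<tau> *\<^sub>R axis j 1)) has_vector_derivative partial j g (y + \<tau> *\<^sub>R axis j 1)) (at \<tau>)"
proof -
  have "(g has_derivative frechet_derivative g (at (y + \<tau> *\<^sub>R axis j 1))) (at (y + \<tau> *\<^sub>R axis j 1))"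
    using schwartz_differentiable[OF assms] by (simp add: frechet_derivative_works)
  moreover have "((\<lambda>\<tau>. y + \<tau> *\<^sub>R axis j 1) has_vector_derivative axis j 1) (at \<tau>)"
    by (auto intro!: derivative_eq_intros)
  ultimately show ?thesis
    using vector_derivative_diff_chain_within[of "\<lambda>\<tau>. y + \<tau> *\<^sub>R axis j 1" "axis j 1" \<tau> UNIV g]
    by (auto simp: o_def partial_def intro: has_derivative_at_withinI)
qed

text \<open>Integration by parts: the j-th derivative of exp(-i<\<xi>,y>) g(y) is integrable in y
  and its integral vanishes.\<close>

lemma osc_partial:
  assumes g: "g \<in> schwartz_space"
  shows "osc (partial j g) 0 \<xi> = \<i> * of_real (\<xi> $ j) * osc g 0 \<xi>"
proof -
  define e where "e = (\<lambda>y. cis (0 * (norm y)\<^sup>2 - \<xi> \<bullet> y))"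
  define h where "h = (\<lambda>y. e y * partial j g y + - \<i> * of_real (\<xi> $ j) * (e y * g y))"
  have e: "cis (0 * (norm y)\<^sup>2 - \<xi> \<bullet> y) = e y" for y by (simp add: e_def)
  have int: "integrable lborel (\<lambda>y. e y * g y)" "integrable lborel (\<lambda>y. e y * partial j g y)"
    unfolding e_def by (intro integrable_osc rapid_integrable schwartz_rapid schwartz_partial g)+
  have "(LINT y|lborel. h y) = 0"
  proof (rule integral_directional_derivative)
    show "((\<lambda>\<tau>. e (y + \<tau> *\<^sub>R axis j 1) * g (y + \<tau> *\<^sub>R axis j 1)) has_vector_derivative
        h (y + \<tau> *\<^sub>R axis j 1)) (at \<tau>)" for y \<tau>
    proof -
      have "((\<lambda>\<tau>. \<i> * of_real (- (\<xi> \<bullet> (y + \<tau> *\<^sub>R axis j 1)))) has_vector_derivative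
          \<i> * of_real (- (\<xi> $ j))) (at \<tau>)"
        by (intro has_vector_derivative_mult_right has_vector_derivative_of_real)
          (auto intro!: derivative_eq_intros simp: inner_axis inner_add_right
            simp flip: has_real_derivative_iff_has_vector_derivative)
      from field_vector_diff_chain_at[OF this DERIV_exp]
      have "((\<lambda>\<tau>. e (y + \<tau> *\<^sub>R axis j 1)) has_vector_derivative
          \<i> * of_real (- (\<xi> $ j)) * e (y + \<tau> *\<^sub>R axis j 1)) (at \<tau>)"
        by (simp add: o_def e_def cis_conv_exp)
      from has_vector_derivative_mult[OF this schwartz_directional[OF g]]
      show ?thesis
        by (simp add: h_def algebra_simps)
    qed
    show "continuous_on UNIV h"
      unfolding h_def e_def
      by (intro continuous_intros schwartz_continuous schwartz_partial g)
    show "integrable lborel h"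
      unfolding h_def
      by (intro Bochner_Integration.integrable_add integrable_mult_right int)
  qed (rule int)
  then have "osc (partial j g) 0 \<xi> + - \<i> * of_real (\<xi> $ j) * osc g 0 \<xi> = 0"
    unfolding h_def osc_def e using int by simp
  then show ?thesis by simp
qed

lemma norm_osc_le:
  "integrable lborel \<rho> \<Longrightarrow> norm (osc \<rho> a b) \<le> (LINT y|lborel. norm (\<rho> y))"
  unfolding osc_def by (rule order_trans[OF integral_norm_bound]) (simp add: norm_mult)

text \<open>Multiplying the transform by 1 + \<xi>_j^2 amounts to replacing g by g minus its second
  j-th derivative. Each new coordinate thus calls the induction hypothesis for another Schwartz
  function, which is why g is generalized.\<close>

lemma osc_decay:
  assumes "finite A" "g \<in> schwartz_space"
  shows "\<exists>C. \<forall>\<xi>. (\<Prod>j\<in>A. 1 + (\<xi> $ j)\<^sup>2) * norm (osc g 0 \<xi>) \<le> C"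
  using assms
proof (induction A arbitrary: g rule: finite_induct)
  case empty
  then show ?case
    using norm_osc_le[OF rapid_integrable[OF schwartz_rapid]] by auto
next
  case (insert j A)
  obtain C where C: "\<And>\<xi>. (\<Prod>j\<in>A. 1 + (\<xi> $ j)\<^sup>2) * norm (osc g 0 \<xi>) \<le> C"
    using insert.IH[OF insert.prems] by blast
  obtain C' where C': "\<And>\<xi>. (\<Prod>j\<in>A. 1 + (\<xi> $ j)\<^sup>2) * norm (osc (partial j (partial j g)) 0 \<xi>) \<le> C'"
    using insert.IH[OF schwartz_partial[OF schwartz_partial[OF insert.prems]]] by blast
  have "(\<Prod>j\<in>insert j A. 1 + (\<xi> $ j)\<^sup>2) * norm (osc g 0 \<xi>) \<le> C + C'" for \<xi>
  proof -
    have "norm (osc (partial j (partial j g)) 0 \<xi>) = (\<xi> $ j)\<^sup>2 * norm (osc g 0 \<xi>)"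
      using insert.prems
      by (simp add: osc_partial schwartz_partial norm_mult power2_eq_square)
    then show ?thesis
      using add_mono[OF C[of \<xi>] C'[of \<xi>]] insert.hyps
      by (simp add: algebra_simps)
  qed
  then show ?case by blast
qed

lemma schwartz_integrable_osc:
  fixes g :: "real^'m::finite \<Rightarrow> complex"
  assumes g: "g \<in> schwartz_space"
  shows "integrable lborel (osc g 0)"
proof -
  obtain C where C: "\<And>\<xi>. (\<Prod>j\<in>UNIV. 1 + (\<xi> $ j)\<^sup>2) * norm (osc g 0 \<xi>) \<le> C"
    using osc_decay[OF _ g, of UNIV] by auto
  show ?thesis
  proof (rule Bochner_Integration.integrable_bound)
    show "integrable lborel (\<lambda>\<xi>::real^'m. C * (\<Prod>b\<in>Basis. inverse (1 + (\<xi> \<bullet> b)\<^sup>2)))"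
      by (intro integrable_mult_right integrable_prod_inverse_1_plus_square)
    have "continuous_on UNIV (osc g 0)"
      using continuous_on_compose2[OF continuous_osc[OF rapid_integrable[OF schwartz_rapid[OF g]]],
          of UNIV "\<lambda>\<xi>. (0, \<xi>)"]
      by (simp add: continuous_on_Pair)
    then show "osc g 0 \<in> borel_measurable lborel"
      by (simp add: borel_measurable_continuous_onI)
    have "norm (osc g 0 \<xi>) \<le> C * (\<Prod>b\<in>Basis. inverse (1 + (\<xi> \<bullet> b)\<^sup>2))" for \<xi>
    proof -
      have "(\<Prod>j\<in>UNIV. 1 + (\<xi> $ j)\<^sup>2) > 0"
        by (intro prod_pos) (auto simp: add_pos_nonneg)
      moreover have "(\<Prod>b\<in>Basis. inverse (1 + (\<xi> \<bullet> b)\<^sup>2)) = inverse (\<Prod>j\<in>UNIV. 1 + (\<xi> $ j)\<^sup>2)"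
        using prod_inversef[of "\<lambda>j. 1 + (\<xi> $ j)\<^sup>2" UNIV] by (simp add: o_def prod_Basis_vec inner_axis)
      ultimately show ?thesis
        using C[of \<xi>] by (simp add: divide_inverse[symmetric] pos_le_divide_eq mult.commute)
    qed
    then show "AE \<xi> in lborel. norm (osc g 0 \<xi>) \<le> norm (C * (\<Prod>b\<in>Basis. inverse (1 + (\<xi> \<bullet> b)\<^sup>2)))"
      by (intro AE_I2) (smt (verit) real_norm_def)
  qed
qed

section \<open>Derivatives of the solution formula\<close>

abbreviation times_norm_sq :: "(real^'m::finite \<Rightarrow> complex) \<Rightarrow> real^'m \<Rightarrow> complex" where
  "times_norm_sq \<rho> \<equiv> \<lambda>y. of_real ((norm y)\<^sup>2) * \<rho> y"

abbreviation times_coord :: "'m::finite \<Rightarrow> (real^'m \<Rightarrow> complex) \<Rightarrow> real^'m \<Rightarrow> complex" where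
  "times_coord j \<rho> \<equiv> \<lambda>y. of_real (y $ j) * \<rho> y"

lemma rapid_times_coord: "rapid \<rho> \<Longrightarrow> rapid (times_coord j \<rho>)"
  using rapid_mult_coordinate[of \<rho> "axis j 1"] by (simp add: inner_axis norm_axis_1)

lemma osc_times_norm_sq:
  assumes "rapid \<rho>"
  shows "osc (times_norm_sq \<rho>) a b = (\<Sum>j\<in>UNIV. osc (times_coord j (times_coord j \<rho>)) a b)"
proof -
  have "times_norm_sq \<rho> y = (\<Sum>j\<in>UNIV. times_coord j (times_coord j \<rho>) y)" for y
  proof -
    have "(norm y)\<^sup>2 = (\<Sum>j\<in>UNIV. y $ j * y $ j)"
      by (simp add: power2_norm_eq_inner inner_vec_def)
    then show ?thesis
      by (simp only: of_real_sum of_real_mult sum_distrib_right mult.assoc)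
  qed
  then show ?thesis
    using integrable_osc[OF rapid_integrable[OF rapid_times_coord[OF rapid_times_coord[OF assms]]]]
    by (simp add: osc_def sum_distrib_left Bochner_Integration.integral_sum)
qed

text \<open>The rewritten solution with amplitude \<open>c\<close> and weight \<rho> left free.
  Derivatives then stay within the family: they are combinations of waves whose weights carry
  polynomial factors.\<close>

definition wave :: "(real \<Rightarrow> complex) \<Rightarrow> (real^'m::finite \<Rightarrow> complex) \<Rightarrow> real^'m \<Rightarrow> real \<Rightarrow> complex" where
  "wave c \<rho> x t = c t * exp ((1 + \<i> * of_real (cot t)) / 4 * of_real ((norm x)\<^sup>2))
      * osc \<rho> (cot t / 4) (inverse (2 * sin t) *\<^sub>R x)"

text \<open>Differentiating the exponent (1 + i cot t)|x|^2 / 4 in x_j brings down this factor times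
  x_j.\<close>

definition drift :: "real \<Rightarrow> complex" where
  "drift t = (1 + \<i> * of_real (cot t)) / 2"

text \<open>Differentiating exp(-i<x,y>/(2 sin t)) in x_j brings down minus this factor times
  y_j.\<close>

definition freq :: "real \<Rightarrow> complex" where
  "freq t = \<i> * of_real (inverse (2 * sin t))"

lemma wave_sum:
  assumes "rapid \<rho>"
  shows "wave c (times_norm_sq \<rho>) x t = (\<Sum>j\<in>UNIV. wave c (times_coord j (times_coord j \<rho>)) x t)"
  by (simp only: wave_def osc_times_norm_sq[OF assms] sum_distrib_left)

lemma wave_has_derivative:
  assumes \<rho>: "rapid \<rho>"
  shows "((\<lambda>z. wave c \<rho> z t) has_derivative (\<lambda>h. \<Sum>j\<in>UNIV. of_real (h $ j)
      * (drift t * of_real (x $ j) * wave c \<rho> x t - freq t * wave c (times_coord j \<rho>) x t))) (at x)"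
proof -
  define A where "A = (1 + \<i> * of_real (cot t)) / 4"
  define s where "s = inverse (2 * sin t)"
  have wave: "wave c \<rho> z t = c t * exp (A * of_real ((norm z)\<^sup>2)) * osc \<rho> (cot t / 4) (s *\<^sub>R z)" for z \<rho>
    by (simp only: wave_def A_def s_def)
  have freq: "freq t = \<i> * of_real s"
    by (simp only: freq_def s_def)
  define D where "D = (\<lambda>h. \<i> * (of_real 0 * osc (times_norm_sq \<rho>) (cot t / 4) (s *\<^sub>R x)
        - (\<Sum>i\<in>Basis. of_real (s *\<^sub>R h \<bullet> i) * osc (\<lambda>y. of_real (y \<bullet> i) * \<rho> y) (cot t / 4) (s *\<^sub>R x))))"
  have "((\<lambda>z. (cot t / 4, s *\<^sub>R z)) has_derivative (\<lambda>h. (0, s *\<^sub>R h))) (at x)"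
    by (auto intro!: derivative_eq_intros)
  from diff_chain_at[OF this osc_has_derivative[OF \<rho>]]
  have osc: "((\<lambda>z. osc \<rho> (cot t / 4) (s *\<^sub>R z)) has_derivative D) (at x)"
    by (simp add: o_def D_def)
  have "((\<lambda>z. (norm z)\<^sup>2) has_derivative (\<lambda>h. 2 * (x \<bullet> h))) (at x)"
    unfolding power2_norm_eq_inner
    by (auto intro!: derivative_eq_intros simp: inner_commute)
  then have "((\<lambda>z. A * of_real ((norm z)\<^sup>2)) has_derivative (\<lambda>h. A * of_real (2 * (x \<bullet> h)))) (at x)"
    by (intro has_derivative_mult_right has_derivative_of_real)
  moreover have "(exp has_derivative (*) (exp (A * of_real ((norm x)\<^sup>2)))) (at (A * of_real ((norm x)\<^sup>2)))"
    using DERIV_exp by (simp add: has_field_derivative_def)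
  ultimately have "((\<lambda>z. exp (A * of_real ((norm z)\<^sup>2))) has_derivative
      (\<lambda>h. exp (A * of_real ((norm x)\<^sup>2)) * (A * of_real (2 * (x \<bullet> h))))) (at x)"
    using diff_chain_at[of "\<lambda>z. A * of_real ((norm z)\<^sup>2)" _ x exp] by (simp add: o_def)
  from has_derivative_mult_right[OF has_derivative_mult[OF this osc], of "c t"]
  have "((\<lambda>z. wave c \<rho> z t) has_derivative (\<lambda>h. c t * (exp (A * of_real ((norm x)\<^sup>2)) * D h
      + exp (A * of_real ((norm x)\<^sup>2)) * (A * of_real (2 * (x \<bullet> h))) * osc \<rho> (cot t / 4) (s *\<^sub>R x)))) (at x)"
    by (simp add: wave mult.assoc)
  also have "(\<lambda>h. c t * (exp (A * of_real ((norm x)\<^sup>2)) * D h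
      + exp (A * of_real ((norm x)\<^sup>2)) * (A * of_real (2 * (x \<bullet> h))) * osc \<rho> (cot t / 4) (s *\<^sub>R x)))
    = (\<lambda>h. \<Sum>j\<in>UNIV. of_real (h $ j)
      * (drift t * of_real (x $ j) * wave c \<rho> x t - freq t * wave c (times_coord j \<rho>) x t))"
  proof
    fix h
    define E where "E = exp (A * of_real ((norm x)\<^sup>2))"
    have D: "D h = (\<Sum>j\<in>UNIV. - freq t * of_real (h $ j) * osc (times_coord j \<rho>) (cot t / 4) (s *\<^sub>R x))"
      by (simp add: D_def sum_Basis_vec inner_axis freq sum_distrib_left mult_ac sum_negf)
    have X: "of_real (2 * (x \<bullet> h)) = (\<Sum>j\<in>UNIV. 2 * of_real (x $ j) * complex_of_real (h $ j))"
      by (simp add: inner_vec_def sum_distrib_left mult.assoc)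
    show "c t * (exp (A * of_real ((norm x)\<^sup>2)) * D h
      + exp (A * of_real ((norm x)\<^sup>2)) * (A * of_real (2 * (x \<bullet> h))) * osc \<rho> (cot t / 4) (s *\<^sub>R x))
      = (\<Sum>j\<in>UNIV. of_real (h $ j)
      * (drift t * of_real (x $ j) * wave c \<rho> x t - freq t * wave c (times_coord j \<rho>) x t))"
      unfolding D X sum_distrib_left sum_distrib_right sum.distrib[symmetric]
        wave E_def[symmetric]
    proof (rule sum.cong[OF refl])
      fix j
      have "drift t = 2 * A" by (simp add: drift_def A_def)
      then show "c t * (E * (- freq t * of_real (h $ j) * osc (times_coord j \<rho>) (cot t / 4) (s *\<^sub>R x))
          + E * (A * (2 * of_real (x $ j) * of_real (h $ j))) * osc \<rho> (cot t / 4) (s *\<^sub>R x))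
        = of_real (h $ j) * (drift t * of_real (x $ j) * (c t * E * osc \<rho> (cot t / 4) (s *\<^sub>R x))
          - freq t * (c t * E * osc (times_coord j \<rho>) (cot t / 4) (s *\<^sub>R x)))"
        by (simp add: algebra_simps)
    qed
  qed
  finally show ?thesis .
qed

lemma axis_1_nth: "axis i (1::real) $ j = (if i = j then 1 else 0)"
  by (auto simp: axis_def)

lemma partial_wave:
  assumes "rapid \<rho>"
  shows "partial i (\<lambda>z. wave c \<rho> z t)
    = (\<lambda>x. drift t * of_real (x $ i) * wave c \<rho> x t - freq t * wave c (times_coord i \<rho>) x t)"
  by (rule ext, subst partial_eqI[OF wave_has_derivative[OF assms]])
     (simp add: axis_1_nth if_distrib[of "\<lambda>x. x * _"] if_distrib[of complex_of_real] cong: if_cong)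

text \<open>Existence of the derivative and its values on the axes are delivered together: the
  former is the regularity of the first partial derivatives, the latter gives the second
  ones.\<close>

lemma partial_wave_has_derivative:
  assumes "rapid \<rho>"
  shows "\<exists>D. (partial i (\<lambda>z. wave c \<rho> z t) has_derivative D) (at x) \<and>
    (\<forall>j. D (axis j 1) =
      drift t * (if i = j then 1 else 0) * wave c \<rho> x t
      + drift t * of_real (x $ i) * (drift t * of_real (x $ j) * wave c \<rho> x t - freq t * wave c (times_coord j \<rho>) x t)
      - freq t * (drift t * of_real (x $ j) * wave c (times_coord i \<rho>) x t
        - freq t * wave c (times_coord j (times_coord i \<rho>)) x t))"
proof -
  obtain D1 where d1: "((\<lambda>z. wave c \<rho> z t) has_derivative D1) (at x)"
    using wave_has_derivative[OF assms] by blast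
  obtain D2 where d2: "((\<lambda>z. wave c (times_coord i \<rho>) z t) has_derivative D2) (at x)"
    using wave_has_derivative[OF rapid_times_coord[OF assms]] by blast
  have "((\<lambda>z::real^'a. drift t * of_real (z $ i)) has_derivative (\<lambda>h. drift t * of_real (h $ i))) (at x)"
    by (intro has_derivative_mult_right has_derivative_of_real bounded_linear_imp_has_derivative
        bounded_linear_vec_nth)
  from has_derivative_diff[OF has_derivative_mult[OF this d1] has_derivative_mult_right[OF d2, of "freq t"]]
  have "(partial i (\<lambda>z. wave c \<rho> z t) has_derivative
      (\<lambda>h. drift t * of_real (x $ i) * D1 h + drift t * of_real (h $ i) * wave c \<rho> x t - freq t * D2 h)) (at x)"
    by (simp only: partial_wave[OF assms])
  moreover have "D1 (axis j 1) = drift t * of_real (x $ j) * wave c \<rho> x t - freq t * wave c (times_coord j \<rho>) x t" for j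
    using partial_eqI[OF d1, of j] by (simp add: partial_wave[OF assms])
  moreover have "D2 (axis j 1) = drift t * of_real (x $ j) * wave c (times_coord i \<rho>) x t
      - freq t * wave c (times_coord j (times_coord i \<rho>)) x t" for j
    using partial_eqI[OF d2, of j] by (simp add: partial_wave[OF rapid_times_coord[OF assms]])
  ultimately show ?thesis
    by (intro exI conjI) (assumption, simp add: axis_1_nth)
qed

lemma partial_partial_wave:
  assumes "rapid \<rho>"
  shows "partial j (partial i (\<lambda>z. wave c \<rho> z t)) x =
      drift t * (if i = j then 1 else 0) * wave c \<rho> x t
      + drift t * of_real (x $ i) * (drift t * of_real (x $ j) * wave c \<rho> x t - freq t * wave c (times_coord j \<rho>) x t)
      - freq t * (drift t * of_real (x $ j) * wave c (times_coord i \<rho>) x t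
        - freq t * wave c (times_coord j (times_coord i \<rho>)) x t)"
  using partial_wave_has_derivative[OF assms, of i c t x] by (auto simp: partial_eqI)

text \<open>Here \<open>d\<close> is the logarithmic derivative of the amplitude. The derivative of
  cot t / 4 is -1/(4 sin^2 t) = \<open>(freq t)\<^sup>2\<close>, which is why |x|^2 and |y|^2
  receive the same coefficient; the sum over j comes from the motion of x / (2 sin t).\<close>

lemma wave_has_vector_derivative:
  assumes \<rho>: "rapid \<rho>" and t: "sin t \<noteq> 0"
    and c: "(c has_vector_derivative d * c t) (at t)"
  shows "((\<lambda>s. wave c \<rho> x s) has_vector_derivative
     (d + \<i> * (freq t)\<^sup>2 * of_real ((norm x)\<^sup>2)) * wave c \<rho> x t
     + \<i> * (freq t)\<^sup>2 * wave c (times_norm_sq \<rho>) x t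
     + of_real (cot t) * freq t * (\<Sum>j\<in>UNIV. of_real (x $ j) * wave c (times_coord j \<rho>) x t)) (at t)"
proof -
  define E where "E = (\<lambda>t. exp ((1 + \<i> * of_real (cot t)) / 4 * of_real ((norm x)\<^sup>2)))"
  define O1 where "O1 = (\<lambda>t. osc \<rho> (cot t / 4) (inverse (2 * sin t) *\<^sub>R x))"
  define S where "S = (\<Sum>j\<in>UNIV. of_real (x $ j) * osc (times_coord j \<rho>) (cot t / 4) (inverse (2 * sin t) *\<^sub>R x))"
  define N where "N = osc (times_norm_sq \<rho>) (cot t / 4) (inverse (2 * sin t) *\<^sub>R x)"
  have fsq: "(freq t)\<^sup>2 = of_real (- inverse ((sin t)\<^sup>2) / 4)"
    by (simp add: freq_def power_mult_distrib field_simps power2_eq_square)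
  have cot: "(cot has_real_derivative - inverse ((sin t)\<^sup>2)) (at t)"
    using t by (rule DERIV_cot)
  have "((\<lambda>s. (1 + \<i> * of_real (cot s)) / 4 * of_real ((norm x)\<^sup>2)) has_vector_derivative
      (0 + \<i> * of_real (- inverse ((sin t)\<^sup>2))) / 4 * of_real ((norm x)\<^sup>2)) (at t)"
    using cot
    by (intro has_vector_derivative_mult_left has_vector_derivative_divide has_vector_derivative_add
        has_vector_derivative_const has_vector_derivative_mult_right has_vector_derivative_of_real)
      (simp add: has_real_derivative_iff_has_vector_derivative)
  from field_vector_diff_chain_at[OF this DERIV_exp]
  have E: "(E has_vector_derivative \<i> * (freq t)\<^sup>2 * of_real ((norm x)\<^sup>2) * E t) (at t)"
    unfolding fsq by (simp add: E_def o_def field_simps)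
  have cot4: "((\<lambda>s. cot s / 4) has_real_derivative - inverse ((sin t)\<^sup>2) / 4) (at t)"
    by (rule DERIV_cdivide[OF cot])
  have "((\<lambda>s. inverse (2 * sin s)) has_real_derivative - cot t * inverse (2 * sin t)) (at t)"
    using t by (auto intro!: derivative_eq_intros simp: cot_def field_simps power2_eq_square)
  then have inv: "((\<lambda>s. inverse (2 * sin s) *\<^sub>R x) has_vector_derivative (- cot t * inverse (2 * sin t)) *\<^sub>R x) (at t)"
    by (intro has_vector_derivative_scaleR[THEN has_vector_derivative_eq_rhs]) auto
  have "(O1 has_vector_derivative \<i> * (freq t)\<^sup>2 * N + of_real (cot t) * freq t * S) (at t)"
    unfolding O1_def
  proof (rule has_vector_derivative_eq_rhs[OF osc_has_vector_derivative[OF \<rho> cot4 inv]])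
    have "(\<Sum>i\<in>Basis. of_real ((- cot t * inverse (2 * sin t)) *\<^sub>R x \<bullet> i)
        * osc (\<lambda>y. of_real (y \<bullet> i) * \<rho> y) (cot t / 4) (inverse (2 * sin t) *\<^sub>R x))
      = of_real (- cot t * inverse (2 * sin t)) * S"
      by (simp add: S_def sum_Basis_vec inner_axis sum_distrib_left mult.assoc)
    then show "\<i> * (of_real (- inverse ((sin t)\<^sup>2) / 4) * osc (times_norm_sq \<rho>) (cot t / 4) (inverse (2 * sin t) *\<^sub>R x)
        - (\<Sum>i\<in>Basis. of_real ((- cot t * inverse (2 * sin t)) *\<^sub>R x \<bullet> i)
        * osc (\<lambda>y. of_real (y \<bullet> i) * \<rho> y) (cot t / 4) (inverse (2 * sin t) *\<^sub>R x)))
      = \<i> * (freq t)\<^sup>2 * N + of_real (cot t) * freq t * S"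
      unfolding fsq N_def by (simp add: freq_def algebra_simps)
  qed
  from has_vector_derivative_mult[OF has_vector_derivative_mult[OF c E] this]
  have "((\<lambda>s. wave c \<rho> x s) has_vector_derivative
     c t * E t * (\<i> * (freq t)\<^sup>2 * N + of_real (cot t) * freq t * S)
     + (c t * (\<i> * (freq t)\<^sup>2 * of_real ((norm x)\<^sup>2) * E t) + d * c t * E t) * O1 t) (at t)"
    by (simp add: wave_def[abs_def] E_def O1_def)
  moreover have "wave c \<rho> x t = c t * E t * O1 t" "wave c (times_norm_sq \<rho>) x t = c t * E t * N"
    "(\<Sum>j\<in>UNIV. of_real (x $ j) * wave c (times_coord j \<rho>) x t) = c t * E t * S"
    by (simp_all add: wave_def E_def O1_def N_def S_def sum_distrib_left mult_ac)
  ultimately show ?thesis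
    by (simp add: algebra_simps)
qed

section \<open>The differential equation\<close>

lemma open_J_times: "open J_times"
  by (simp add: J_times_def J_plus_def J_minus_def open_Un)

lemma sin_J_times: "t \<in> J_times \<Longrightarrow> sin t \<noteq> 0"
  using sin_gt_zero[of t] sin_lt_zero[of t] by (auto simp: J_times_def J_plus_def J_minus_def)

lemma continuous_on_cot_compose:
  fixes g :: "'a::metric_space \<Rightarrow> real"
  assumes "continuous_on S g" "\<And>x. x \<in> S \<Longrightarrow> sin (g x) \<noteq> 0"
  shows "continuous_on S (\<lambda>x. cot (g x))"
  unfolding cot_def using assms by (intro continuous_intros) auto

lemma continuous_on_wave:
  fixes \<rho> :: "real^'m::finite \<Rightarrow> complex"
  assumes "rapid \<rho>" and c: "continuous_on J_times c"
  shows "continuous_on (UNIV \<times> J_times) (\<lambda>(x, t). wave c \<rho> x t)"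
proof -
  have sin: "sin (snd p) \<noteq> 0" if "p \<in> UNIV \<times> J_times" for p :: "(real^'m) \<times> real"
    using that sin_J_times by auto
  have c': "continuous_on (UNIV \<times> J_times) (\<lambda>p::(real^'m) \<times> real. c (snd p))"
    by (rule continuous_on_compose2[OF c]) (auto intro!: continuous_intros)
  have cot: "continuous_on (UNIV \<times> J_times) (\<lambda>p::(real^'m) \<times> real. cot (snd p))"
    by (intro continuous_on_cot_compose continuous_intros sin)
  have arg: "continuous_on (UNIV \<times> J_times) (\<lambda>p::(real^'m) \<times> real. (cot (snd p) / 4, inverse (2 * sin (snd p)) *\<^sub>R fst p))"
    by (intro continuous_intros cot) (use sin_J_times in auto)
  have osc: "continuous_on (UNIV \<times> J_times) (\<lambda>p. osc \<rho> (cot (snd p) / 4) (inverse (2 * sin (snd p)) *\<^sub>R fst p))"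
    using continuous_on_compose2[OF continuous_osc[OF rapid_integrable[OF assms(1)]] arg]
    unfolding fst_conv snd_conv by blast
  show ?thesis
    unfolding wave_def case_prod_beta
    by (intro continuous_intros c' osc cot) auto
qed

text \<open>With A = \<open>drift t\<close> and \<kappa> = \<open>freq t\<close>, the operator
  produces the coefficients A^2 - A and 1 - 2A. The identities A^2 - A = \<kappa>^2, a form of cot^2
  + 1 = 1/sin^2, and i (1 - 2A) = cot t turn the result into the time derivative of a wave whose
  amplitude has logarithmic derivative i m A.\<close>

lemma wave_solves_pde:
  fixes \<rho> :: "real^'m::finite \<Rightarrow> complex"
  assumes \<rho>: "rapid \<rho>" and t: "sin t \<noteq> 0"
  shows "\<i> * (laplacian (\<lambda>z. wave c \<rho> z t) x - pairing x (gradient (\<lambda>z. wave c \<rho> z t) x))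
    = (\<i> * of_nat CARD('m) * drift t + \<i> * (freq t)\<^sup>2 * of_real ((norm x)\<^sup>2)) * wave c \<rho> x t
     + \<i> * (freq t)\<^sup>2 * wave c (times_norm_sq \<rho>) x t
     + of_real (cot t) * freq t * (\<Sum>j\<in>UNIV. of_real (x $ j) * wave c (times_coord j \<rho>) x t)"
proof -
  define A \<kappa> W W1 W2 where "A = drift t" and "\<kappa> = freq t" and "W = wave c \<rho> x t"
    and "W1 = (\<lambda>j. wave c (times_coord j \<rho>) x t)"
    and "W2 = (\<lambda>j. wave c (times_coord j (times_coord j \<rho>)) x t)"
  have A1: "\<i> * (1 - 2 * A) = of_real (cot t)"
  proof -
    have "2 * A = 1 + \<i> * of_real (cot t)" by (simp add: A_def drift_def)
    then show ?thesis by simp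
  qed
  have A2: "A\<^sup>2 - A = \<kappa>\<^sup>2"
  proof -
    have "(cot t)\<^sup>2 + 1 = (inverse (sin t))\<^sup>2"
      using t sin_cos_squared_add[of t] by (simp add: cot_def field_simps)
    moreover have "A\<^sup>2 - A = - of_real ((cot t)\<^sup>2 + 1) / 4"
      by (simp add: A_def drift_def power2_eq_square field_simps)
    moreover have "\<kappa>\<^sup>2 = - of_real ((inverse (sin t))\<^sup>2) / 4"
      by (simp add: \<kappa>_def freq_def power_mult_distrib power_divide)
    ultimately show ?thesis by (simp only:)
  qed
  have norm: "of_real ((norm x)\<^sup>2) = (\<Sum>j\<in>UNIV. complex_of_real (x $ j) * of_real (x $ j))"
    by (simp add: power2_norm_eq_inner inner_vec_def)
  have "laplacian (\<lambda>z. wave c \<rho> z t) x - pairing x (gradient (\<lambda>z. wave c \<rho> z t) x)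
    = (\<Sum>j\<in>UNIV. A * W + (A\<^sup>2 - A) * (of_real (x $ j) * of_real (x $ j) * W) + \<kappa>\<^sup>2 * W2 j
        + (1 - 2 * A) * \<kappa> * (of_real (x $ j) * W1 j))"
    unfolding laplacian_def partial_partial_wave[OF \<rho>]
    unfolding pairing_def gradient_def partial_wave[OF \<rho>] vec_lambda_beta sum_subtractf[symmetric]
      A_def[symmetric] \<kappa>_def[symmetric] W_def[symmetric]
    by (intro sum.cong) (simp_all add: W1_def W2_def algebra_simps power2_eq_square)
  also have "\<dots> = of_nat CARD('m) * A * W + (A\<^sup>2 - A) * of_real ((norm x)\<^sup>2) * W + \<kappa>\<^sup>2 * (\<Sum>j\<in>UNIV. W2 j)
        + (1 - 2 * A) * \<kappa> * (\<Sum>j\<in>UNIV. of_real (x $ j) * W1 j)"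
    unfolding norm by (simp add: sum.distrib sum_distrib_left sum_distrib_right mult.assoc)
  also have "\<i> * \<dots> = (\<i> * of_nat CARD('m) * A + \<i> * \<kappa>\<^sup>2 * of_real ((norm x)\<^sup>2)) * W
     + \<i> * \<kappa>\<^sup>2 * (\<Sum>j\<in>UNIV. W2 j) + of_real (cot t) * \<kappa> * (\<Sum>j\<in>UNIV. of_real (x $ j) * W1 j)"
    unfolding A1[symmetric] A2[symmetric] by (simp add: algebra_simps)
  finally show ?thesis
    unfolding A_def \<kappa>_def W_def W1_def W2_def wave_sum[OF \<rho>] .
qed

text \<open>One formula covers both intervals: \<open>k\<close> and \<open>k'\<close> are their
  constant factors, and |sin t| absorbs the change of sign at pi.\<close>

definition amplitude :: "nat \<Rightarrow> complex \<Rightarrow> complex \<Rightarrow> real \<Rightarrow> complex" where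
  "amplitude m k k' t = (if t < pi then k else k') * exp (\<i> * of_nat m * of_real t / 2)
      * of_real (\<bar>sin t\<bar> powr (- real m / 2))"

text \<open>The exponential contributes i m / 2 to the logarithmic derivative and the power of |sin
  t| contributes -(m/2) cot t; together they are i m \<open>drift t\<close>.\<close>

lemma amplitude_has_vector_derivative:
  assumes t: "t \<in> J_times"
  shows "(amplitude m k k' has_vector_derivative \<i> * of_nat m * drift t * amplitude m k k' t) (at t)"
proof -
  define K where "K = (if t < pi then k else k')"
  \<comment> \<open>On the interval containing t the sine has constant sign, so |sin s| = \<sigma>
    sin s is differentiable there and the case distinction at pi is frozen.\<close>
  define \<sigma> :: real where "\<sigma> = (if t < pi then 1 else - 1)"
  define S where "S = (if t < pi then J_plus else J_minus)"
  have S: "open S" "t \<in> S"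
    using t by (auto simp: S_def J_times_def J_plus_def J_minus_def)
  have S': "s < pi \<longleftrightarrow> t < pi" "\<bar>sin s\<bar> = \<sigma> * sin s" "\<sigma> * sin s > 0" if "s \<in> S" for s
    using that sin_gt_zero[of s] sin_lt_zero[of s]
    by (auto simp: S_def \<sigma>_def J_plus_def J_minus_def split: if_splits)
  have "((\<lambda>s. (\<sigma> * sin s) powr (- real m / 2)) has_real_derivative
      - real m / 2 * cot t * (\<sigma> * sin t) powr (- real m / 2)) (at t)"
  proof (rule DERIV_cong[OF DERIV_fun_powr])
    show "((\<lambda>s. \<sigma> * sin s) has_real_derivative \<sigma> * cos t) (at t)"
      by (auto intro!: derivative_eq_intros)
    show "- real m / 2 * (\<sigma> * sin t) powr (- real m / 2 - of_nat 1) * (\<sigma> * cos t)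
        = - real m / 2 * cot t * (\<sigma> * sin t) powr (- real m / 2)"
      using S'(3)[OF S(2)] by (simp add: cot_def powr_diff \<sigma>_def)
  qed (rule S'(3)[OF S(2)])
  then have p: "((\<lambda>s. complex_of_real ((\<sigma> * sin s) powr (- real m / 2))) has_vector_derivative
      of_real (- real m / 2 * cot t * (\<sigma> * sin t) powr (- real m / 2))) (at t)"
    by (intro has_vector_derivative_of_real) (simp add: has_real_derivative_iff_has_vector_derivative)
  have "((\<lambda>s. \<i> * of_nat m / 2 * of_real s) has_vector_derivative \<i> * of_nat m / 2 * of_real 1) (at t)"
    by (intro has_vector_derivative_mult_right has_vector_derivative_of_real)
      (auto simp flip: has_real_derivative_iff_has_vector_derivative)
  from field_vector_diff_chain_at[OF this DERIV_exp]
  have e: "((\<lambda>s. exp (\<i> * of_nat m * of_real s / 2)) has_vector_derivative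
      \<i> * of_nat m / 2 * exp (\<i> * of_nat m * of_real t / 2)) (at t)"
    by (simp add: o_def)
  have "((\<lambda>s. K * exp (\<i> * of_nat m * of_real s / 2) * of_real ((\<sigma> * sin s) powr (- real m / 2)))
      has_vector_derivative \<i> * of_nat m * drift t * amplitude m k k' t) (at t)"
    by (rule has_vector_derivative_eq_rhs[OF has_vector_derivative_mult[OF has_vector_derivative_mult_right[OF e] p]])
       (simp add: amplitude_def drift_def S'(2)[OF S(2)] K_def[symmetric] field_simps)
  then show ?thesis
    by (rule has_vector_derivative_transform_within_open[OF _ S]) (simp add: amplitude_def S' K_def)
qed

lemma continuous_on_amplitude: "continuous_on J_times (amplitude m k k')"
  by (intro continuous_at_imp_continuous_on ballI)
    (rule has_vector_derivative_continuous[OF amplitude_has_vector_derivative])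

text \<open>Because \<open>J_times\<close> is open, agreement with a wave on it carries over to time
  derivatives. Every derivative required is a finite combination of waves with continuous
  coefficients.\<close>

lemma C21_on_J_wave:
  fixes \<rho> :: "real^'m::finite \<Rightarrow> complex"
  assumes \<rho>: "rapid \<rho>" and f: "\<And>x t. t \<in> J_times \<Longrightarrow> f x t = wave (amplitude CARD('m) k k') \<rho> x t"
  shows "C21_on_J f"
    and "t \<in> J_times \<Longrightarrow> vector_derivative (\<lambda>s. f x s) (at t)
          - \<i> * (laplacian (\<lambda>z. f z t) x - pairing x (gradient (\<lambda>z. f z t) x)) = 0"
proof -
  let ?c = "amplitude CARD('m) k k'"
  let ?U = "(UNIV :: (real^'m) set) \<times> J_times"
  define T where "T x t = (\<i> * of_nat CARD('m) * drift t + \<i> * (freq t)\<^sup>2 * of_real ((norm x)\<^sup>2)) * wave ?c \<rho> x t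
     + \<i> * (freq t)\<^sup>2 * wave ?c (times_norm_sq \<rho>) x t
     + of_real (cot t) * freq t * (\<Sum>j\<in>UNIV. of_real (x $ j) * wave ?c (times_coord j \<rho>) x t)" for x t
  have ft: "(\<lambda>z. f z t) = (\<lambda>z. wave ?c \<rho> z t)" if "t \<in> J_times" for t
    using f that by auto
  have deriv: "((\<lambda>s. f x s) has_vector_derivative T x t) (at t)" if t: "t \<in> J_times" for x t
    unfolding T_def
    by (rule has_vector_derivative_transform_within_open[OF wave_has_vector_derivative[OF \<rho> sin_J_times[OF t]
        amplitude_has_vector_derivative[OF t]] open_J_times t]) (simp add: f)
  then have vd: "vector_derivative (\<lambda>s. f x s) (at t) = T x t" if "t \<in> J_times" for x t
    using that by (intro vector_derivative_at)
  show "vector_derivative (\<lambda>s. f x s) (at t)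
          - \<i> * (laplacian (\<lambda>z. f z t) x - pairing x (gradient (\<lambda>z. f z t) x)) = 0" if t: "t \<in> J_times"
    unfolding vd[OF t] ft[OF t] wave_solves_pde[OF \<rho> sin_J_times[OF t]] T_def by simp
  have sin: "sin (snd p) \<noteq> 0" if "p \<in> ?U" for p
    using that sin_J_times by auto
  have W: "continuous_on ?U (\<lambda>p. wave ?c \<rho>' (fst p) (snd p))" if "rapid \<rho>'" for \<rho>'
    using continuous_on_wave[OF that continuous_on_amplitude] by (simp add: case_prod_beta)
  have cot: "continuous_on ?U (\<lambda>p. cot (snd p))"
    by (intro continuous_on_cot_compose continuous_intros sin)
  have drift: "continuous_on ?U (\<lambda>p. drift (snd p))"
    unfolding drift_def by (intro continuous_intros cot) auto
  have freq: "continuous_on ?U (\<lambda>p. freq (snd p))"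
    unfolding freq_def by (intro continuous_intros) (use sin_J_times in auto)
  have rapid2: "rapid (times_norm_sq \<rho>)"
    by (rule rapid_mult_norm_sq) (rule \<rho>)
  note rapid = \<rho> rapid_times_coord[OF \<rho>] rapid_times_coord[OF rapid_times_coord[OF \<rho>]] rapid2
  have contT: "continuous_on ?U (\<lambda>p. T (fst p) (snd p))"
    unfolding T_def by (intro continuous_intros W rapid drift freq cot)
  have cont_partials: "continuous_on ?U (\<lambda>p. partials ks (\<lambda>z. wave ?c \<rho> z (snd p)) (fst p))"
    if "length ks \<le> 2" for ks
  proof -
    consider "ks = []" | i where "ks = [i]" | i j where "ks = [i, j]"
      using \<open>length ks \<le> 2\<close> by (auto simp: le_Suc_eq numeral_2_eq_2 length_Suc_conv)
    then show ?thesis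
    proof cases
      case 1
      then show ?thesis using W[OF \<rho>] by (simp add: partials_def)
    next
      case 2
      then show ?thesis
        by (simp add: partials_def partial_wave[OF \<rho>]) (intro continuous_intros W rapid drift freq)
    next
      case 3
      then show ?thesis
        by (simp add: partials_def partial_partial_wave[OF \<rho>] split del: if_split)
          (intro continuous_intros W rapid drift freq)
    qed
  qed
  have diff_partials: "partials ks (\<lambda>z. wave ?c \<rho> z t) differentiable (at x)" if len: "length ks < 2" for ks t x
  proof -
    consider "ks = []" | i where "ks = [i]"
      \<comment> \<open>This case rule separates lists of length zero, one and at least two.\<close>
      using len by (cases ks rule: remdups_adj.cases) auto
    then show ?thesis
    proof cases
      case 1
      then show ?thesis
        using wave_has_derivative[OF \<rho>] by (auto simp: partials_def differentiable_def)
    next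
      case 2
      then show ?thesis
        using partial_wave_has_derivative[OF \<rho>, of _ ?c t x] by (auto simp: partials_def differentiable_def)
    qed
  qed
  show "C21_on_J f"
    unfolding C21_on_J_def
  proof (intro conjI ballI allI impI)
    show "(\<lambda>s. f x s) differentiable (at t)" if "t \<in> J_times" for t x
      using deriv[OF that] by (rule differentiableI_vector)
    show "continuous_on ?U (\<lambda>(x, t). vector_derivative (\<lambda>s. f x s) (at t))"
      by (rule continuous_on_cong[THEN iffD2, OF refl _ contT]) (auto simp: vd)
    show "partials ks (\<lambda>z. f z t) differentiable (at x)" if "t \<in> J_times" "length ks < 2" for t ks x
      using diff_partials[OF that(2)] by (simp add: ft[OF that(1)])
    show "continuous_on ?U (\<lambda>(x, t). partials ks (\<lambda>z. f z t) x)" if "length ks \<le> 2" for ks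
      by (rule continuous_on_cong[THEN iffD2, OF refl _ cont_partials[OF that]]) (auto simp: ft)
  qed
qed

section \<open>The initial condition\<close>

text \<open>Since exp(i t) = cos t + i sin t, the quotient by 4 sin t gives |x|^2 and |y|^2 the
  common phase cot t / 4 and opposite real exponents: -1/4 for |y|^2, which turns \<phi> into
  \<psi>, and +1/4 for |x|^2.\<close>

lemma exp_bilin_sq:
  assumes "sin t \<noteq> 0"
  shows "exp (\<i> * (bilin_sq t x y / of_real (4 * sin t)))
    = exp ((1 + \<i> * of_real (cot t)) / 4 * of_real ((norm x)\<^sup>2))
      * (cis (cot t / 4 * (norm y)\<^sup>2 - inverse (2 * sin t) *\<^sub>R x \<bullet> y) * of_real (exp (- (norm y)\<^sup>2 / 4)))"
proof -
  have e: "exp (\<i> * of_real t) = of_real (cos t) + \<i> * of_real (sin t)"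
    "exp (- \<i> * of_real t) = of_real (cos t) - \<i> * of_real (sin t)"
    by (simp_all add: exp_Euler exp_minus_Euler cos_of_real sin_of_real)
  have "\<i> * (bilin_sq t x y / of_real (4 * sin t))
    = (1 + \<i> * of_real (cot t)) / 4 * of_real ((norm x)\<^sup>2)
      + (\<i> * of_real (cot t / 4 * (norm y)\<^sup>2 - inverse (2 * sin t) *\<^sub>R x \<bullet> y) + of_real (- (norm y)\<^sup>2 / 4))"
    unfolding bilin_sq_def e using assms
    by (simp add: cot_def field_simps)
  then show ?thesis
    by (simp only: exp_add cis_conv_exp exp_of_real)
qed

lemma powr_minus_half:
  assumes "x > 0" shows "x powr (- real m / 2) = inverse (sqrt x ^ m)"
proof -
  have "sqrt x ^ m = x powr (1 / 2 * real m)"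
    using assms by (simp add: powr_half_sqrt[symmetric] powr_realpow[symmetric] powr_powr)
  then show ?thesis by (simp add: powr_minus[symmetric])
qed

text \<open>The principal root of i is the source of the phase exp(i pi m / 4) in the formula on
  J^+.\<close>

lemma csqrt_imaginary:
  assumes "s > 0" shows "csqrt (\<i> * of_real s) = of_real (sqrt s) * cis (pi / 4)"
proof (rule csqrt_unique)
  have "cis (pi / 4) ^ 2 = cis (real 2 * (pi / 4))"
    by (rule Complex.DeMoivre)
  also have "real 2 * (pi / 4) = pi / 2" by simp
  finally have "cis (pi / 4) ^ 2 = \<i>" by simp
  then show "(complex_of_real (sqrt s) * cis (pi / 4))\<^sup>2 = \<i> * of_real s"
    using assms by (simp add: power_mult_distrib flip: of_real_power)
  show "0 < Re (of_real (sqrt s) * cis (pi / 4)) \<or> Re (of_real (sqrt s) * cis (pi / 4)) = 0 \<and> 0 \<le> Im (of_real (sqrt s) * cis (pi / 4))"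
    using assms by (simp add: cos_45)
qed

text \<open>Completing the square in the phase and applying the inversion formula with \<open>s = tan t\<close>,
  \<open>z = x / cos t\<close> replaces the singular integral by one that is continuous up to \<open>t = 0\<close>.\<close>

definition regular_wave :: "(real^'m::finite \<Rightarrow> complex) \<Rightarrow> real^'m \<Rightarrow> real \<Rightarrow> complex" where
  "regular_wave \<psi> x t = of_real (inverse ((2 * pi * sqrt (cos t)) ^ CARD('m)))
     * exp (\<i> * of_nat CARD('m) * of_real t / 2) * of_real (exp ((norm x)\<^sup>2 / 4))
     * cis (- tan t * (norm x)\<^sup>2 / 4) * osc (osc \<psi> 0) (- tan t) (- (inverse (cos t) *\<^sub>R x))"

text \<open>The phase |y - x / cos t|^2 / (4 tan t) exceeds that of the integrand of
  \<open>wave\<close> by |x|^2 / (4 sin t cos t). By cot t = 1/(sin t cos t) - tan t this term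
  cancels against the prefactor, leaving -tan t |x|^2 / 4. Below pi/2 both cos t and tan t are
  positive, so the real roots factor.\<close>

lemma wave_eq_regular_wave:
  fixes \<psi> :: "real^'m::finite \<Rightarrow> complex"
  assumes \<psi>: "\<psi> \<in> schwartz_space" and t: "0 < t" "t < pi / 2"
  shows "wave (amplitude CARD('m) (of_real ((4 * pi) powr (- real CARD('m) / 2)) / exp (\<i> * of_real pi * of_nat CARD('m) / 4)) k')
    \<psi> x t = regular_wave \<psi> x t"
proof -
  let ?m = "CARD('m)"
  define z where "z = inverse (cos t) *\<^sub>R x"
  define Q where "Q = osc \<psi> (cot t / 4) (inverse (2 * sin t) *\<^sub>R x)"
  have pos: "sin t > 0" "cos t > 0" "tan t > 0"
    using t by (auto intro: sin_gt_zero cos_gt_zero tan_gt_zero)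
  have sq: "sqrt (tan t) = sqrt (sin t) / sqrt (cos t)"
    by (simp add: tan_def real_sqrt_divide)
  have "cis ((norm (y - z))\<^sup>2 / (4 * tan t)) * \<psi> y
      = cis ((norm x)\<^sup>2 / (4 * sin t * cos t)) * (cis (cot t / 4 * (norm y)\<^sup>2 - inverse (2 * sin t) *\<^sub>R x \<bullet> y) * \<psi> y)" for y
  proof -
    have "(norm (y - z))\<^sup>2 = (norm y)\<^sup>2 - 2 / cos t * (x \<bullet> y) + (norm x)\<^sup>2 / (cos t)\<^sup>2"
    proof -
      have "(norm (y - z))\<^sup>2 = (norm y)\<^sup>2 - 2 * (z \<bullet> y) + (norm z)\<^sup>2"
        by (simp add: power2_norm_eq_inner inner_diff_left inner_diff_right inner_commute)
      moreover have "z \<bullet> y = x \<bullet> y / cos t" "(norm z)\<^sup>2 = (norm x)\<^sup>2 / (cos t)\<^sup>2"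
        by (simp_all add: z_def power_mult_distrib divide_inverse power_inverse)
      ultimately show ?thesis by simp
    qed
    then have "(norm (y - z))\<^sup>2 / (4 * tan t)
      = (norm x)\<^sup>2 / (4 * sin t * cos t) + (cot t / 4 * (norm y)\<^sup>2 - inverse (2 * sin t) *\<^sub>R x \<bullet> y)"
      using pos by (simp add: tan_def cot_def field_simps power2_eq_square)
    then show ?thesis
      by (simp only: cis_mult[symmetric] mult.assoc)
  qed
  then have "(LINT y|lborel. cis ((norm (y - z))\<^sup>2 / (4 * tan t)) * \<psi> y) = cis ((norm x)\<^sup>2 / (4 * sin t * cos t)) * Q"
    unfolding Q_def osc_def by (simp only: integral_mult_right_zero)
  then have osc: "osc (osc \<psi> 0) (- tan t) (- z)
      = (of_real (sqrt pi) / (of_real (sqrt (tan t)) * cis (pi / 4))) ^ ?m * (cis ((norm x)\<^sup>2 / (4 * sin t * cos t)) * Q)"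
    using osc_osc[OF rapid_integrable[OF schwartz_rapid[OF \<psi>]] schwartz_integrable_osc[OF \<psi>] pos(3), of z]
    by (simp add: csqrt_imaginary[OF pos(3)])
  have e: "exp (\<i> * of_real pi * of_nat ?m / 4) = cis (pi / 4) ^ ?m"
  proof -
    have "exp (\<i> * of_real pi * of_nat ?m / 4) = cis (real ?m * (pi / 4))"
      unfolding cis_conv_exp by (rule arg_cong[where f = exp]) simp
    also have "\<dots> = cis (pi / 4) ^ ?m"
      by (rule Complex.DeMoivre[symmetric])
    finally show ?thesis .
  qed
  \<comment> \<open>The identity is checked once per dimension and raised to the m-th power: both
    sides have the base 1 / (2 sqrt(pi) sqrt(sin t)).\<close>
  have const: "inverse (sqrt (4 * pi) ^ ?m) * inverse (sqrt (sin t) ^ ?m)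
      = inverse ((2 * pi * sqrt (cos t)) ^ ?m) * (sqrt pi / sqrt (tan t)) ^ ?m"
  proof -
    have "inverse (sqrt (4 * pi)) * inverse (sqrt (sin t)) = inverse (2 * pi * sqrt (cos t)) * (sqrt pi / sqrt (tan t))"
      using pos by (simp add: sq real_sqrt_mult field_simps)
    then show ?thesis
      by (simp only: power_inverse[symmetric] power_mult_distrib[symmetric])
  qed
  have amp: "amplitude ?m (of_real ((4 * pi) powr (- real ?m / 2)) / exp (\<i> * of_real pi * of_nat ?m / 4)) k' t
    = of_real (inverse ((2 * pi * sqrt (cos t)) ^ ?m)) * exp (\<i> * of_nat ?m * of_real t / 2)
      * (of_real (sqrt pi) / (of_real (sqrt (tan t)) * cis (pi / 4))) ^ ?m"
  proof -
    have powr: "(4 * pi) powr (- real ?m / 2) = inverse (sqrt (4 * pi) ^ ?m)"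
      "\<bar>sin t\<bar> powr (- real ?m / 2) = inverse (sqrt (sin t) ^ ?m)"
      using powr_minus_half[of "4 * pi" ?m] powr_minus_half[OF pos(1), of ?m] pos(1)
      by (simp_all only: abs_of_pos) simp
    have "t < pi" using t by simp
    have "amplitude ?m (of_real ((4 * pi) powr (- real ?m / 2)) / exp (\<i> * of_real pi * of_nat ?m / 4)) k' t
      = of_real (inverse (sqrt (4 * pi) ^ ?m) * inverse (sqrt (sin t) ^ ?m)) * exp (\<i> * of_nat ?m * of_real t / 2) / cis (pi / 4) ^ ?m"
      unfolding amplitude_def e powr if_P[OF \<open>t < pi\<close>]
      by (simp only: of_real_mult divide_inverse mult_ac)
    also have "\<dots> = of_real (inverse ((2 * pi * sqrt (cos t)) ^ ?m)) * exp (\<i> * of_nat ?m * of_real t / 2)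
      * (of_real (sqrt pi) / (of_real (sqrt (tan t)) * cis (pi / 4))) ^ ?m"
      unfolding const power_divide power_mult_distrib[of "of_real (sqrt (tan t))"]
      by (simp only: of_real_mult of_real_power of_real_inverse of_real_divide power_divide divide_inverse
          inverse_mult_distrib mult_ac)
    finally show ?thesis .
  qed
  have ex: "exp ((1 + \<i> * of_real (cot t)) / 4 * of_real ((norm x)\<^sup>2))
    = of_real (exp ((norm x)\<^sup>2 / 4)) * cis (- tan t * (norm x)\<^sup>2 / 4) * cis ((norm x)\<^sup>2 / (4 * sin t * cos t))"
  proof -
    have cot: "cot t = - tan t + 1 / (sin t * cos t)"
      using pos sin_cos_squared_add[of t] by (simp add: cot_def tan_def field_simps power2_eq_square)
    have "cot t * (norm x)\<^sup>2 / 4 = - tan t * (norm x)\<^sup>2 / 4 + (norm x)\<^sup>2 / (4 * sin t * cos t)"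
      unfolding cot distrib_right add_divide_distrib by (simp add: mult_ac)
    moreover have "(1 + \<i> * of_real (cot t)) / 4 * of_real ((norm x)\<^sup>2)
      = of_real ((norm x)\<^sup>2 / 4) + \<i> * of_real (cot t * (norm x)\<^sup>2 / 4)"
      by (simp add: field_simps)
    ultimately show ?thesis
      by (simp only: exp_add exp_of_real cis_conv_exp[symmetric] cis_mult[symmetric] mult.assoc)
  qed
  show ?thesis
    unfolding wave_def regular_wave_def amp ex z_def[symmetric] osc Q_def[symmetric] by (simp only: mult_ac)
qed

text \<open>The prefactor (2 pi)^(-m) left at t = 0 cancels the constant of Fourier
  inversion.\<close>

lemma regular_wave_0:
  assumes \<psi>: "\<psi> \<in> schwartz_space"
  shows "regular_wave \<psi> x 0 = of_real (exp ((norm x)\<^sup>2 / 4)) * \<psi> x"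
proof -
  obtain B where B: "\<And>y. norm (\<psi> y) \<le> B"
    using schwartz_bounded[OF \<psi>, of 0] by auto
  show ?thesis
    using fourier_inversion[OF rapid_integrable[OF schwartz_rapid[OF \<psi>]] schwartz_integrable_osc[OF \<psi>]
        schwartz_continuous[OF \<psi>] B, of x]
    by (simp add: regular_wave_def power_mult_distrib field_simps)
qed

lemma continuous_on_regular_wave:
  fixes \<psi> :: "real^'m::finite \<Rightarrow> complex"
  assumes \<psi>: "\<psi> \<in> schwartz_space"
  shows "continuous_on (UNIV \<times> {0..<pi / 2}) (\<lambda>(x, t). regular_wave \<psi> x t)"
proof -
  let ?U = "(UNIV :: (real^'m) set) \<times> {0..<pi / 2}"
  have cos: "cos t \<noteq> 0" if "0 \<le> t" "t * 2 < pi" for t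
    using that cos_gt_zero_pi[of t] by simp
  have tan: "continuous_on ?U (\<lambda>p. tan (snd p))"
    unfolding tan_def by (intro continuous_intros) (auto simp: cos)
  have arg: "continuous_on ?U (\<lambda>p. (- tan (snd p), - (inverse (cos (snd p)) *\<^sub>R fst p)))"
    by (intro continuous_intros tan) (auto simp: cos)
  have "continuous_on ?U (\<lambda>p. osc (osc \<psi> 0) (- tan (snd p)) (- (inverse (cos (snd p)) *\<^sub>R fst p)))"
    using continuous_on_compose2[OF continuous_osc[OF schwartz_integrable_osc[OF \<psi>]] arg]
    unfolding fst_conv snd_conv by blast
  then show ?thesis
    unfolding regular_wave_def case_prod_beta
    by (intro continuous_intros tan) (auto simp: cos)
qed

theorem proposition1p1:
  fixes \<phi> :: "real^'m::finite \<Rightarrow> complex" and f :: "real^'m \<Rightarrow> real \<Rightarrow> complex"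
  defines "m \<equiv> CARD('m)"
  assumes phi: "\<phi> \<in> K_space"
    and f_plus: "\<And>x t. t \<in> J_plus \<Longrightarrow>
      f x t = of_real ((4 * pi) powr (- real m / 2)) * exp (\<i> * of_nat m * of_real t / 2)
          / (exp (\<i> * of_real pi * of_nat m / 4) * of_real (sin t powr (real m / 2)))
        * (LINT y|lborel. exp (\<i> * (bilin_sq t x y / of_real (4 * sin t))) * \<phi> y)"
    and f_minus: "\<And>x t. t \<in> J_minus \<Longrightarrow>
      f x t = of_real ((4 * pi) powr (- real m / 2)) * exp (\<i> * of_nat m * of_real t / 2)
          / (exp (\<i> * 3 * of_real pi * of_nat m / 4) * of_real (\<bar>sin t\<bar> powr (real m / 2)))
        * (LINT y|lborel. exp (- \<i> * (bilin_sq t x y / of_real (4 * \<bar>sin t\<bar>))) * \<phi> y)"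
    and f_zero: "\<And>x. f x 0 = \<phi> x"
  shows "solves_cauchy_problem \<phi> f"
proof -
  define \<psi> where "\<psi> = (\<lambda>x. of_real (exp (- (norm x)\<^sup>2 / 4)) * \<phi> x)"
  have \<psi>: "\<psi> \<in> schwartz_space"
    using phi by (simp add: K_space_def \<psi>_def)
  define k where "k = complex_of_real ((4 * pi) powr (- real m / 2)) / exp (\<i> * of_real pi * of_nat m / 4)"
  define k' where "k' = complex_of_real ((4 * pi) powr (- real m / 2)) / exp (\<i> * 3 * of_real pi * of_nat m / 4)"
  have int: "(LINT y|lborel. exp (\<i> * (bilin_sq t x y / of_real (4 * sin t))) * \<phi> y)
      = exp ((1 + \<i> * of_real (cot t)) / 4 * of_real ((norm x)\<^sup>2))
        * osc \<psi> (cot t / 4) (inverse (2 * sin t) *\<^sub>R x)" if "sin t \<noteq> 0" for x t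
    unfolding exp_bilin_sq[OF that] osc_def \<psi>_def
    by (simp only: integral_mult_right_zero mult.assoc)
  have f: "f x t = wave (amplitude CARD('m) k k') \<psi> x t" if t: "t \<in> J_times" for x t
  proof (cases "t \<in> J_plus")
    case True
    then have "sin t > 0" and t': "t < pi" by (auto simp: J_plus_def sin_gt_zero)
    then have powr: "\<bar>sin t\<bar> powr (- real m / 2) = inverse (sin t powr (real m / 2))"
      by (simp flip: powr_minus)
    show ?thesis
      unfolding f_plus[OF True] int[OF sin_J_times[OF t]] wave_def amplitude_def m_def[symmetric] powr if_P[OF t'] k_def
      by (simp only: divide_inverse inverse_mult_distrib of_real_inverse mult_ac)
  next
    case False
    then have t_minus: "t \<in> J_minus" using t by (auto simp: J_times_def)
    then have "sin t < 0" and t': "\<not> t < pi" by (auto simp: J_minus_def sin_lt_zero)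
    \<comment> \<open>On J^- the sign of -i cancels that of |sin t| = -sin t, so both branches share
      one integrand.\<close>
    then have "- \<i> * (bilin_sq t x y / of_real (4 * \<bar>sin t\<bar>)) = \<i> * (bilin_sq t x y / of_real (4 * sin t))" for y
      by simp
    then have int': "(LINT y|lborel. exp (- \<i> * (bilin_sq t x y / of_real (4 * \<bar>sin t\<bar>))) * \<phi> y)
      = exp ((1 + \<i> * of_real (cot t)) / 4 * of_real ((norm x)\<^sup>2))
        * osc \<psi> (cot t / 4) (inverse (2 * sin t) *\<^sub>R x)"
      by (simp only: int[OF sin_J_times[OF t]])
    have powr: "\<bar>sin t\<bar> powr (- real m / 2) = inverse (\<bar>sin t\<bar> powr (real m / 2))"
      by (simp flip: powr_minus)
    show ?thesis
      unfolding f_minus[OF t_minus] int' wave_def amplitude_def m_def[symmetric] powr if_not_P[OF t'] k'_def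
      by (simp only: divide_inverse inverse_mult_distrib of_real_inverse mult_ac)
  qed
  note solution = C21_on_J_wave[OF schwartz_rapid[OF \<psi>], of f, OF f]
  \<comment> \<open>Fourier inversion covers t = 0 and the rewritten formula covers t > 0, so the
    continuity of \<open>f\<close> down to the initial time is that of
    \<open>regular_wave\<close>.\<close>
  have f0: "f x t = regular_wave \<psi> x t" if "t \<in> {0..<pi / 2}" for x t
  proof (cases "t = 0")
    case True
    have "of_real (exp ((norm x)\<^sup>2 / 4)) * \<psi> x = \<phi> x"
      by (simp add: \<psi>_def exp_minus flip: of_real_mult)
    then show ?thesis
      using True by (simp add: f_zero regular_wave_0[OF \<psi>])
  next
    case False
    then have t: "0 < t" "t < pi / 2" using that by auto
    then have "t \<in> J_times" by (auto simp: J_times_def J_plus_def)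
    then show ?thesis
      using wave_eq_regular_wave[OF \<psi> t] by (simp add: f k_def m_def)
  qed
  have "continuous_on (UNIV \<times> insert 0 J_times) (\<lambda>(x, t). f x t)"
  proof -
    let ?S = "(UNIV :: (real^'m) set) \<times> {0..<pi / 2}" and ?T = "(UNIV :: (real^'m) set) \<times> J_times"
    have S: "continuous_on ?S (\<lambda>(x, t). f x t)"
      by (rule continuous_on_cong[THEN iffD2, OF refl _ continuous_on_regular_wave[OF \<psi>]]) (auto simp: f0)
    \<comment> \<open>Continuity of \<open>f\<close> on the open time set is the zeroth-order case
      of the regularity already established.\<close>
    have "continuous_on ?T (\<lambda>(x, t). partials [] (\<lambda>z. f z t) x)"
      using solution(1) unfolding C21_on_J_def by (metis le0 list.size(3))
    then have T: "continuous_on ?T (\<lambda>(x, t). f x t)"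
      by (simp add: partials_def)
    have U: "?S \<union> ?T = UNIV \<times> insert 0 J_times"
      using pi_gt_zero by (auto simp: J_times_def J_plus_def J_minus_def)
    \<comment> \<open>The interval \<open>{0..<pi / 2}\<close> is relatively open in
      \<open>insert 0 J_times\<close>, which has no negative points; continuity on two relatively
      open pieces gives continuity on their union.\<close>
    have "?S = (?S \<union> ?T) \<inter> (UNIV \<times> {..<pi / 2})"
      using pi_gt_zero by (auto simp: J_times_def J_plus_def J_minus_def)
    then have "openin (top_of_set (?S \<union> ?T)) ?S"
      unfolding openin_open by (metis open_Times open_UNIV open_lessThan)
    moreover have "?T = (?S \<union> ?T) \<inter> ?T" by blast
    then have "openin (top_of_set (?S \<union> ?T)) ?T"
      unfolding openin_open by (metis open_Times open_UNIV open_J_times)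
    ultimately show ?thesis
      unfolding U[symmetric] using S T by (rule continuous_on_Un_local_open)
  qed
  then show ?thesis
    unfolding solves_cauchy_problem_def using solution f_zero by blast
qed

end
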